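(* Let $0<T<\infty$, let $r\ge 16$ be an integer, and let $u_0\in H^r$ be real-valued and $2\pi$-periodic. For each positive integer $N$ let $U=U_N:[0,\infty)\to S_N$ be the real-valued solution of the semi-discrete problem $$(U_t+UU_x+U_{xxx}-U_{xxxxx},\phi)=0\quad\text{for all }\phi\in S_N,\ t\ge0,\qquad U(0)=P_Nu_0.$$ Then there exist constants $C_1>0$ and $C>0$, independent of $N$ and $\Delta t$, such that the following holds. Let $N,M$ be positive integers, $\Delta t=T/M$, $t_m=m\Delta t$, and suppose $$N\Delta t\le C_1.$$ Let $U^0,\dots,U^M\in S_N$ be real-valued with $U^0=U(0)$ and satisfy the Crank–Nicolson scheme $$(U^{m+1}-U^m,\phi)+\Delta t\,\bigl(U^{m+1/2}U^{m+1/2}_x+U^{m+1/2}_{xxx}-U^{m+1/2}_{xxxxx},\phi\bigr)=0\quad\text{for all }\phi\in S_N,\ 0\le m\le M-1,$$ where $U^{m+1/2}=\frac12(U^m+U^{m+1})$. Then $$\max_{0\le m\le M}\|U^m-U(t_m)\|\le C\,\Delta t^2.$$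
   Context: All functions are $2\pi$-periodic in $x$; function spaces are on $[-\pi,\pi]$. $(f,g)=\int_{-\pi}^{\pi} f\,\overline{g}\,dx$ is the $L^2$ inner product and $\|\cdot\|$ its norm. With $\hat f(k)=\frac1{2\pi}\int_{-\pi}^{\pi}e^{-ikx}f(x)\,dx$, the periodic Sobolev space $H^r$ has norm $\|f\|_r=\left(\sum_{k\in\mathbb Z}(1+k^2)^r|\hat f(k)|^2\right)^{1/2}$. $S_N=\mathrm{span}\{e^{ikx}: k\in\mathbb Z,\ -N\le k\le N\}$ and $P_N$ is the $L^2$-orthogonal projection onto $S_N$. The semi-discrete problem has a unique real-valued solution for all $t\ge0$. Constants may depend on $T$, $r$ and $u_0$. *)

theory Defs
  imports "HOL-Analysis.Analysis"
begin

definition real_valued :: "(real \<Rightarrow> complex) \<Rightarrow> bool" where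
  "real_valued f \<longleftrightarrow> (\<forall>x. f x \<in> \<real>)"

definition periodic_2pi :: "(real \<Rightarrow> complex) \<Rightarrow> bool" where
  "periodic_2pi f \<longleftrightarrow> (\<forall>x. f (x + 2 * pi) = f x)"

definition L2_per :: "(real \<Rightarrow> complex) set" where
  "L2_per = {f. periodic_2pi f \<and> set_borel_measurable lebesgue {-pi..pi} f \<and>
      set_integrable lebesgue {-pi..pi} (\<lambda>x. (cmod (f x))\<^sup>2)}"

definition L2_inner :: "(real \<Rightarrow> complex) \<Rightarrow> (real \<Rightarrow> complex) \<Rightarrow> complex" where
  "L2_inner f g = (LINT x:{-pi..pi}|lebesgue. f x * cnj (g x))"

definition L2_norm :: "(real \<Rightarrow> complex) \<Rightarrow> real" where
  "L2_norm f = sqrt (Re (L2_inner f f))"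

definition fourier_coeff :: "(real \<Rightarrow> complex) \<Rightarrow> int \<Rightarrow> complex" where
  "fourier_coeff f k =
     (LINT x:{-pi..pi}|lebesgue. exp (- \<i> * of_int k * of_real x) * f x) / of_real (2 * pi)"

definition H_per :: "nat \<Rightarrow> (real \<Rightarrow> complex) set" where
  "H_per r = {f \<in> L2_per.
     (\<lambda>k::int. (1 + (real_of_int k)\<^sup>2) ^ r * (cmod (fourier_coeff f k))\<^sup>2) summable_on UNIV}"

definition trig_polys :: "nat \<Rightarrow> (real \<Rightarrow> complex) set" where
  "trig_polys N = {f. \<exists>c :: int \<Rightarrow> complex.
     f = (\<lambda>x. \<Sum>k\<in>{- int N..int N}. c k * exp (\<i> * of_int k * of_real x))}"

text \<open>
  The elements of \<^term>\<open>trig_polys N\<close> are continuous, so the orthogonal projection is unique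
  as a function and not only almost everywhere.
\<close>

definition L2_proj :: "nat \<Rightarrow> (real \<Rightarrow> complex) \<Rightarrow> (real \<Rightarrow> complex)" where
  "L2_proj N f = (THE p. p \<in> trig_polys N \<and>
     (\<forall>\<phi>\<in>trig_polys N. L2_inner (\<lambda>x. f x - p x) \<phi> = 0))"

definition dx :: "(real \<Rightarrow> complex) \<Rightarrow> (real \<Rightarrow> complex)" where
  "dx f = (\<lambda>x. vector_derivative f (at x))"

definition spatial_op :: "(real \<Rightarrow> complex) \<Rightarrow> (real \<Rightarrow> complex)" where
  "spatial_op f = (\<lambda>x. f x * dx f x + (dx ^^ 3) f x - (dx ^^ 5) f x)"

text \<open>
  Functions of time and space are written \<open>U t x\<close> and constrained for \<open>t \<ge> 0\<close> only; the time
  derivative is taken within \<open>[0,\<infinity>)\<close>, hence is one-sided at \<open>t = 0\<close>. As \<^term>\<open>trig_polys N\<close> is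
  finite-dimensional, differentiability in time for every fixed \<open>x\<close> is the same as
  differentiability of the \<^term>\<open>trig_polys N\<close>-valued map.
\<close>

definition dt_U :: "(real \<Rightarrow> real \<Rightarrow> complex) \<Rightarrow> real \<Rightarrow> (real \<Rightarrow> complex)" where
  "dt_U U t = (\<lambda>x. vector_derivative (\<lambda>s. U s x) (at t within {0..}))"

definition semidiscrete_solution ::
    "nat \<Rightarrow> (real \<Rightarrow> complex) \<Rightarrow> (real \<Rightarrow> real \<Rightarrow> complex) \<Rightarrow> bool" where
  "semidiscrete_solution N u0 U \<longleftrightarrow>
     (\<forall>t\<ge>0. U t \<in> trig_polys N \<and> real_valued (U t)) \<and>
     (\<forall>t\<ge>0. \<forall>x. (\<lambda>s. U s x) differentiable (at t within {0..})) \<and>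
     (\<forall>t\<ge>0. \<forall>\<phi>\<in>trig_polys N. L2_inner (\<lambda>x. dt_U U t x + spatial_op (U t) x) \<phi> = 0) \<and>
     U 0 = L2_proj N u0"

definition midpoint_step :: "(nat \<Rightarrow> real \<Rightarrow> complex) \<Rightarrow> nat \<Rightarrow> (real \<Rightarrow> complex)" where
  "midpoint_step V m = (\<lambda>x. (V m x + V (Suc m) x) / 2)"

definition crank_nicolson ::
    "nat \<Rightarrow> nat \<Rightarrow> real \<Rightarrow> (real \<Rightarrow> complex) \<Rightarrow> (nat \<Rightarrow> real \<Rightarrow> complex) \<Rightarrow> bool" where
  "crank_nicolson N M \<Delta>t v0 V \<longleftrightarrow>
     (\<forall>m\<le>M. V m \<in> trig_polys N \<and> real_valued (V m)) \<and>
     V 0 = v0 \<and>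
     (\<forall>m<M. \<forall>\<phi>\<in>trig_polys N.
        L2_inner (\<lambda>x. V (Suc m) x - V m x) \<phi>
        + of_real \<Delta>t * L2_inner (spatial_op (midpoint_step V m)) \<phi> = 0)"

end

theory Submission
  imports Defs
begin

text \<open>
  Everything is done on the Fourier coefficients. The truncation keeps the Hamiltonian structure of the
  equation, so the semidiscrete solution conserves its mass and the energy
  \<open>\<Sum>(k\<^sup>2 + k\<^sup>4) |c\<^sub>k|\<^sup>2 - (1/3) \<Sum> c\<^sub>i c\<^sub>j c\<^sub>l\<close> (over \<open>i + j + l = 0\<close>); this bounds \<open>\<Sum>|k c\<^sub>k|\<close>
  uniformly in time and \<open>N\<close>. By symmetry, \<open>\<Sum>k\<^sup>2\<^sup>s |c\<^sub>k|\<^sup>2\<close> grows at the rate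
  \<open>(1/3) \<Sum>(i\<^sup>n + j\<^sup>n + l\<^sup>n) c\<^sub>i c\<^sub>j c\<^sub>l\<close> with \<open>n = 2 s + 1\<close>, which is at most a constant times
  \<open>\<Sum>|k c\<^sub>k|\<close> times the same sum, so Gronwall's inequality bounds all Sobolev norms on \<open>[0, T]\<close>.
  Three time derivatives cost fifteen space derivatives in the Wiener algebra, and \<open>H\<^sup>1\<^sup>6\<close> controls
  these. Hence the Crank--Nicolson defect is of third order per step, and the scheme is stable because
  the error equation, tested with the midpoint error, only involves the gradient of the semidiscrete
  solution. The condition on \<open>N \<Delta>t\<close> only serves to make \<open>\<Delta>t\<close> small in the discrete Gronwall inequality.
\<close>

section \<open>Sums over resonant triads\<close>

text \<open>Every constant must be uniform in \<open>N\<close>. A growth estimate for a Sobolev norm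
  alone is superlinear and would close only on a short time interval; the conserved Hamiltonian
  bounds the gradient for all times and thereby makes the growth linear. Its quadratic symbol
  \<open>k^2 + k^4\<close> is exactly what the embedding of \<open>H^1\<close> into absolutely
  convergent Fourier series asks for \<open>k c_k\<close>. The same embedding explains the exponent
  16: fifteen derivatives plus one. The discrete solution is never estimated by itself. The error is
  measured against the semidiscrete solution, whose gradient alone enters the stability bound, so no
  inverse inequality or bootstrap occurs. The dispersion has an imaginary symbol and drops out of
  all weighted quadratic sums; it acts only through the Hamiltonian and through the five space
  derivatives paid per time derivative. Wiener norms suit the consistency estimate because they form
  an algebra with constant one and because duality reduces the mean value estimates to scalar
  functions.\<close>

definition modes :: "nat \<Rightarrow> int set" where
  "modes N = {- int N..int N}"

lemma finite_modes [simp]: "finite (modes N)"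
  by (simp add: modes_def)

lemma uminus_in_modes [simp]: "- k \<in> modes N \<longleftrightarrow> k \<in> modes N"
  by (auto simp: modes_def)

lemma sum_modes_uminus: "(\<Sum>k\<in>modes N. f (- k)) = (\<Sum>k\<in>modes N. f k)"
  by (rule sum.reindex_bij_witness[of _ uminus uminus]) auto

text \<open>For \<open>f i j l = a i * b j * c l\<close> this is the constant Fourier coefficient of
  a product of three trigonometric polynomials. Resonance is written \<open>i + j + l = 0\<close> so
  that the three slots are interchangeable and symmetrising a symbol is a permutation of bound
  indices.\<close>

definition triads :: "nat \<Rightarrow> (int \<Rightarrow> int \<Rightarrow> int \<Rightarrow> 'a::comm_monoid_add) \<Rightarrow> 'a" where
  "triads N f = (\<Sum>i\<in>modes N. \<Sum>j\<in>modes N. \<Sum>l\<in>modes N. if i + j + l = 0 then f i j l else 0)"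

lemma triads_cong:
  assumes "\<And>i j l. i \<in> modes N \<Longrightarrow> j \<in> modes N \<Longrightarrow> l \<in> modes N \<Longrightarrow> i + j + l = 0 \<Longrightarrow> f i j l = g i j l"
  shows "triads N f = triads N g"
  unfolding triads_def using assms by (intro sum.cong refl) auto

lemma triads_swap12: "triads N (\<lambda>i j l. f j i l) = triads N f"
  unfolding triads_def by (subst sum.swap) (simp add: add.commute add.left_commute)

lemma triads_swap23: "triads N (\<lambda>i j l. f i l j) = triads N f"
proof -
  have "(\<Sum>j\<in>modes N. \<Sum>l\<in>modes N. if i + j + l = 0 then f i l j else 0)
      = (\<Sum>j\<in>modes N. \<Sum>l\<in>modes N. if i + j + l = 0 then f i j l else 0)" for i
    by (subst sum.swap) (simp add: ac_simps)
  then show ?thesis unfolding triads_def by simp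
qed

lemma triads_swap13: "triads N (\<lambda>i j l. f l j i) = triads N f"
  using triads_swap12[of N "\<lambda>i j l. f l j i"] triads_swap23[of N "\<lambda>i j l. f j l i"]
    triads_swap12[of N f] triads_swap23[of N f]
    triads_swap12[of N "\<lambda>i j l. f i l j"] triads_swap12[of N "\<lambda>i j l. f l i j"]
     triads_swap23[of N "\<lambda>i j l. f j i l"]
  by simp

lemma triads_add: "triads N (\<lambda>i j l. f i j l + g i j l) = triads N f + triads N g"
  unfolding triads_def sum.distrib[symmetric] by (intro sum.cong refl) auto

lemma triads_mult_left:
  fixes f :: "int \<Rightarrow> int \<Rightarrow> int \<Rightarrow> 'a::semiring_0"
  shows "triads N (\<lambda>i j l. a * f i j l) = a * triads N f"
  unfolding triads_def by (simp add: sum_distrib_left if_distrib cong: if_cong)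

lemma norm_triads_le:
  assumes "\<And>i j l. i + j + l = 0 \<Longrightarrow> norm (f i j l) \<le> g i j l"
  shows "norm (triads N f) \<le> triads N g"
  unfolding triads_def by (intro order_trans[OF norm_sum] sum_mono) (auto simp: assms)

lemma triads_mono:
  fixes f :: "int \<Rightarrow> int \<Rightarrow> int \<Rightarrow> real"
  assumes "\<And>i j l. i + j + l = 0 \<Longrightarrow> f i j l \<le> g i j l"
  shows "triads N f \<le> triads N g"
  unfolding triads_def by (intro sum_mono) (auto simp: assms)

text \<open>Young's inequality for \<open>l^1 * l^2\<close>, tested against \<open>l^2\<close>. The
  product \<open>\<beta> j * \<beta> l\<close> splits into two half squares, which exchanging
  \<open>j\<close> and \<open>l\<close> identifies; then \<open>i\<close> and \<open>j\<close> leave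
  at most one resonant \<open>l\<close>, so the triple sum is dominated by a product.\<close>

lemma triads_le_l1_l2:
  fixes \<alpha> \<beta> :: "int \<Rightarrow> real"
  assumes "\<And>k. 0 \<le> \<alpha> k"
  shows "triads N (\<lambda>i j l. \<alpha> i * (\<beta> j * \<beta> l)) \<le> (\<Sum>k\<in>modes N. \<alpha> k) * (\<Sum>k\<in>modes N. (\<beta> k)\<^sup>2)"
proof -
  have half: "triads N (\<lambda>i j l. \<alpha> i * (\<beta> j)\<^sup>2) \<le> (\<Sum>k\<in>modes N. \<alpha> k) * (\<Sum>k\<in>modes N. (\<beta> k)\<^sup>2)"
  proof -
    have "(\<Sum>l\<in>modes N. if i + j + l = 0 then \<alpha> i * (\<beta> j)\<^sup>2 else 0) \<le> \<alpha> i * (\<beta> j)\<^sup>2" for i j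
    proof -
      have eq: "i + j + l = 0 \<longleftrightarrow> - (i + j) = l" for l by arith
      show ?thesis unfolding eq by (simp add: assms)
    qed
    then show ?thesis
      unfolding triads_def sum_product by (intro sum_mono)
  qed
  have *: "\<beta> j * \<beta> l \<le> (\<beta> j)\<^sup>2 / 2 + (\<beta> l)\<^sup>2 / 2" for j l
    using sum_squares_bound[of "\<beta> j" "\<beta> l"] by simp
  have "triads N (\<lambda>i j l. \<alpha> i * (\<beta> j * \<beta> l))
      \<le> triads N (\<lambda>i j l. (1/2) * (\<alpha> i * (\<beta> j)\<^sup>2) + (1/2) * (\<alpha> i * (\<beta> l)\<^sup>2))"
    by (rule triads_mono) (use mult_left_mono[OF * assms] in \<open>simp add: distrib_left\<close>)
  also have "\<dots> = triads N (\<lambda>i j l. \<alpha> i * (\<beta> j)\<^sup>2)"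
    unfolding triads_add triads_mult_left
    using triads_swap23[of N "\<lambda>i j l. \<alpha> i * (\<beta> j)\<^sup>2"] by simp
  finally show ?thesis using half by linarith
qed

section \<open>The symmetrised symbol of the nonlinearity\<close>

text \<open>As \<open>z = - (x + y)\<close> and the exponent is odd, the two large powers form the
  difference \<open>(x + y)^n - y^n\<close>, which is \<open>x\<close> times a sum of
  \<open>n = 2 * s + 1\<close> products of size at most \<open>\<bar>z\<bar>^(2 * s)\<close>. The
  two larger frequencies are comparable, \<open>\<bar>z\<bar> \<le> 2 * \<bar>y\<bar>\<close>, so
  half of these powers pass to \<open>y\<close> at the price \<open>2^s\<close>. The summand 1 in
  the constant covers \<open>x^n\<close>.\<close>

lemma abs_odd_power_sum_ordered:
  fixes x y z :: real
  assumes "x + y + z = 0" "\<bar>x\<bar> \<le> \<bar>y\<bar>" "\<bar>y\<bar> \<le> \<bar>z\<bar>"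
  shows "\<bar>x^(2 * s + 1) + y^(2 * s + 1) + z^(2 * s + 1)\<bar> \<le> (1 + real (2 * s + 1) * 2^s) * (\<bar>x\<bar> * (\<bar>y\<bar>^s * \<bar>z\<bar>^s))"
proof -
  define n where "n = 2 * s + 1"
  have z: "z = - (x + y)" using assms by simp
  have "(x+y)^n - y^n = x * (\<Sum>i<n. y^(n - Suc i) * (x+y)^i)"
    unfolding power_diff_sumr2 by simp
  moreover have "\<bar>y^(n - Suc i) * (x+y)^i\<bar> \<le> \<bar>z\<bar>^(2 * s)" if "i < n" for i
  proof -
    have "\<bar>y^(n - Suc i) * (x+y)^i\<bar> \<le> \<bar>z\<bar>^(n - Suc i) * \<bar>z\<bar>^i"
      using assms(3) unfolding z abs_mult power_abs by (intro mult_mono power_mono) auto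
    also have "\<dots> = \<bar>z\<bar>^(2 * s)" using that by (simp add: n_def power_add[symmetric])
    finally show ?thesis .
  qed
  then have "\<bar>\<Sum>i<n. y^(n - Suc i) * (x+y)^i\<bar> \<le> (\<Sum>i<n. \<bar>z\<bar>^(2 * s))"
    by (intro order_trans[OF sum_abs] sum_mono) auto
  ultimately have 1: "\<bar>(x+y)^n - y^n\<bar> \<le> n * (\<bar>x\<bar> * \<bar>z\<bar>^(2 * s))"
    by (simp add: abs_mult mult_left_mono mult.left_commute)
  have "\<bar>z\<bar> \<le> 2 * \<bar>y\<bar>" using assms by linarith
  then have "\<bar>z\<bar>^s \<le> 2^s * \<bar>y\<bar>^s" by (metis abs_ge_zero power_mono power_mult_distrib)
  then have 2: "\<bar>z\<bar>^(2 * s) \<le> 2^s * (\<bar>y\<bar>^s * \<bar>z\<bar>^s)"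
    by (simp add: mult_2 power_add mult.assoc[symmetric] mult_right_mono)
  have "\<bar>x\<bar>^(2 * s) \<le> \<bar>y\<bar>^s * \<bar>z\<bar>^s"
    unfolding mult_2 power_add using assms by (intro mult_mono power_mono) auto
  then have 3: "\<bar>x\<bar>^n \<le> \<bar>x\<bar> * (\<bar>y\<bar>^s * \<bar>z\<bar>^s)"
    unfolding n_def by (simp add: mult_left_mono)
  have "x^n + y^n + z^n = x^n - ((x+y)^n - y^n)"
    unfolding z by (subst power_minus_odd) (simp_all add: n_def)
  then have "\<bar>x^n + y^n + z^n\<bar> \<le> \<bar>x\<bar>^n + \<bar>(x+y)^n - y^n\<bar>"
    unfolding power_abs[symmetric] by (metis abs_triangle_ineq4)
  also have "\<dots> \<le> \<bar>x\<bar> * (\<bar>y\<bar>^s * \<bar>z\<bar>^s) + n * (\<bar>x\<bar> * (2^s * (\<bar>y\<bar>^s * \<bar>z\<bar>^s)))"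
    using 1 3 2 by (intro add_mono order_trans[OF 1] mult_left_mono) auto
  also have "\<dots> = (1 + real n * 2^s) * (\<bar>x\<bar> * (\<bar>y\<bar>^s * \<bar>z\<bar>^s))"
    by (simp add: algebra_simps)
  finally show ?thesis unfolding n_def .
qed

text \<open>On a resonant triad the symmetrised symbol of the nonlinearity loses only one derivative, and
  that one falls on the smallest frequency.\<close>

lemma abs_odd_power_sum:
  fixes x y z :: real
  assumes "x + y + z = 0"
  shows "\<bar>x^(2 * s + 1) + y^(2 * s + 1) + z^(2 * s + 1)\<bar> \<le> (1 + real (2 * s + 1) * 2^s) *
    (\<bar>x\<bar> * (\<bar>y\<bar>^s * \<bar>z\<bar>^s) + \<bar>y\<bar> * (\<bar>x\<bar>^s * \<bar>z\<bar>^s) + \<bar>z\<bar> * (\<bar>x\<bar>^s * \<bar>y\<bar>^s))"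
proof -
  define C where "C = 1 + real (2 * s + 1) * 2^s"
  define P where "P = \<bar>x\<bar> * (\<bar>y\<bar>^s * \<bar>z\<bar>^s)"
  define Q where "Q = \<bar>y\<bar> * (\<bar>x\<bar>^s * \<bar>z\<bar>^s)"
  define R where "R = \<bar>z\<bar> * (\<bar>x\<bar>^s * \<bar>y\<bar>^s)"
  have C: "C \<ge> 0" and PQR: "P \<ge> 0" "Q \<ge> 0" "R \<ge> 0"
    by (simp_all add: C_def P_def Q_def R_def)
  note [simp] = C_def[symmetric]
  consider "\<bar>x\<bar> \<le> \<bar>y\<bar>" "\<bar>y\<bar> \<le> \<bar>z\<bar>" | "\<bar>x\<bar> \<le> \<bar>z\<bar>" "\<bar>z\<bar> \<le> \<bar>y\<bar>" | "\<bar>y\<bar> \<le> \<bar>x\<bar>" "\<bar>x\<bar> \<le> \<bar>z\<bar>"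
    | "\<bar>y\<bar> \<le> \<bar>z\<bar>" "\<bar>z\<bar> \<le> \<bar>x\<bar>" | "\<bar>z\<bar> \<le> \<bar>x\<bar>" "\<bar>x\<bar> \<le> \<bar>y\<bar>" | "\<bar>z\<bar> \<le> \<bar>y\<bar>" "\<bar>y\<bar> \<le> \<bar>x\<bar>"
    by linarith
  then have "\<bar>x^(2 * s + 1) + y^(2 * s + 1) + z^(2 * s + 1)\<bar> \<le> C * P \<or>
     \<bar>x^(2 * s + 1) + y^(2 * s + 1) + z^(2 * s + 1)\<bar> \<le> C * Q \<or>
     \<bar>x^(2 * s + 1) + y^(2 * s + 1) + z^(2 * s + 1)\<bar> \<le> C * R"
  proof cases
    case 1 then show ?thesis using abs_odd_power_sum_ordered[of x y z s] assms
      unfolding P_def C_def by (simp add: ac_simps)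
  next
    case 2 then show ?thesis using abs_odd_power_sum_ordered[of x z y s] assms
      unfolding P_def C_def by (simp add: ac_simps)
  next
    case 3 then show ?thesis using abs_odd_power_sum_ordered[of y x z s] assms
      unfolding Q_def C_def by (simp add: ac_simps)
  next
    case 4 then show ?thesis using abs_odd_power_sum_ordered[of y z x s] assms
      unfolding Q_def C_def by (simp add: ac_simps)
  next
    case 5 then show ?thesis using abs_odd_power_sum_ordered[of z x y s] assms
      unfolding R_def C_def by (simp add: ac_simps)
  next
    case 6 then show ?thesis using abs_odd_power_sum_ordered[of z y x s] assms
      unfolding R_def C_def by (simp add: ac_simps)
  qed
  moreover have "C * P \<le> C * (P + Q + R)" "C * Q \<le> C * (P + Q + R)" "C * R \<le> C * (P + Q + R)"
    using C PQR by (auto intro!: mult_left_mono)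
  ultimately show ?thesis unfolding C_def[symmetric] P_def[symmetric] Q_def[symmetric] R_def[symmetric] by linarith
qed

section \<open>Sobolev embedding into absolutely convergent series\<close>

lemma sum_inverse_one_plus_square_le: "(\<Sum>k\<in>modes N. 1 / (1 + (real_of_int k)\<^sup>2)) \<le> 5"
proof -
  \<comment> \<open>Strengthened for the induction: the new pair of modes adds at most a difference
    of consecutive values of \<open>4 / (real N + 1)\<close>. The constant is
    \<open>5 = 1 + 4\<close> because the sum equals 1 at \<open>N = 0\<close>.\<close>
  have "(\<Sum>k\<in>modes N. 1 / (1 + (real_of_int k)\<^sup>2)) \<le> 5 - 4 / (real N + 1)"
  proof (induction N)
    case 0 show ?case by (simp add: modes_def)
  next
    case (Suc N)
    have "modes (Suc N) = insert (int N + 1) (insert (- int N - 1) (modes N))"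
      by (auto simp: modes_def)
    moreover have "int N + 1 \<notin> modes N" "- int N - 1 \<notin> modes N" by (auto simp: modes_def)
    ultimately have "(\<Sum>k\<in>modes (Suc N). 1 / (1 + (real_of_int k)\<^sup>2)) =
        2 / (1 + (real N + 1)\<^sup>2) + (\<Sum>k\<in>modes N. 1 / (1 + (real_of_int k)\<^sup>2))"
      by (simp add: power2_eq_square algebra_simps)
    also have "2 / (1 + (real N + 1)\<^sup>2) \<le> 4 / ((real N + 1) * (real N + 2))"
    proof -
      have "2 / a = 4 / (2 * a)" for a :: real by simp
      then have "2 / (1 + (real N + 1)\<^sup>2) = 4 / (2 * (1 + (real N + 1)\<^sup>2))" .
      also have "\<dots> \<le> 4 / ((real N + 1) * (real N + 2))"
        by (rule frac_le) (auto simp: power2_eq_square algebra_simps intro: add_pos_nonneg)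
      finally show ?thesis .
    qed
    also have "4 / ((real N + 1) * (real N + 2)) = 4 / (real N + 1) - 4 / (real (Suc N) + 1)"
      by (simp add: field_simps)
    finally show ?case using Suc.IH by linarith
  qed
  moreover have "4 / (real N + 1) \<ge> 0" by simp
  ultimately show ?thesis by linarith
qed

text \<open>Cauchy--Schwarz against the summable weight \<open>1 / (1 + k^2)\<close>. Passing from
  \<open>l^1\<close> to \<open>l^2\<close> costs one derivative, with a constant free of
  \<open>N\<close>.\<close>

lemma l1_le_sobolev:
  fixes a :: "int \<Rightarrow> real"
  shows "(\<Sum>k\<in>modes N. a k)\<^sup>2 \<le> 5 * (\<Sum>k\<in>modes N. (1 + (real_of_int k)\<^sup>2) * (a k)\<^sup>2)"
proof -
  have p: "1 + (real_of_int k)\<^sup>2 > 0" for k by (simp add: add_pos_nonneg)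
  have "(\<Sum>k\<in>modes N. a k) = (\<Sum>k\<in>modes N. (1 / sqrt (1 + (real_of_int k)\<^sup>2)) * (sqrt (1 + (real_of_int k)\<^sup>2) * a k))"
    by (intro sum.cong refl) (use p in \<open>simp add: less_imp_neq[symmetric] real_sqrt_eq_zero_cancel_iff\<close>)
  then have "(\<Sum>k\<in>modes N. a k)\<^sup>2 \<le> (\<Sum>k\<in>modes N. (1 / sqrt (1 + (real_of_int k)\<^sup>2))\<^sup>2) *
      (\<Sum>k\<in>modes N. (sqrt (1 + (real_of_int k)\<^sup>2) * a k)\<^sup>2)"
    using Cauchy_Schwarz_ineq_sum by metis
  also have "\<dots> = (\<Sum>k\<in>modes N. 1 / (1 + (real_of_int k)\<^sup>2)) * (\<Sum>k\<in>modes N. (1 + (real_of_int k)\<^sup>2) * (a k)\<^sup>2)"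
    using p by (simp add: power_divide power_mult_distrib less_imp_le)
  also have "\<dots> \<le> 5 * (\<Sum>k\<in>modes N. (1 + (real_of_int k)\<^sup>2) * (a k)\<^sup>2)"
    using p by (intro mult_right_mono sum_inverse_one_plus_square_le sum_nonneg mult_nonneg_nonneg) (auto simp: less_imp_le)
  finally show ?thesis .
qed

section \<open>Truncated convolutions and the Wiener algebra\<close>

text \<open>Only the factors are truncated. The output index is free, so the same sum yields all
  coefficients of a product of degree \<open>2 * N\<close> and, on \<open>modes N\<close>, those of
  its projection.\<close>

definition conv :: "nat \<Rightarrow> (int \<Rightarrow> complex) \<Rightarrow> (int \<Rightarrow> complex) \<Rightarrow> int \<Rightarrow> complex" where
  "conv N a b k = (\<Sum>i\<in>modes N. \<Sum>j\<in>modes N. if i + j = k then a i * b j else 0)"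

lemma conv_commute: "conv N a b k = conv N b a k"
  unfolding conv_def by (subst sum.swap) (intro sum.cong refl, simp add: add.commute mult.commute)

lemma sum_conv_eq_triads:
  "(\<Sum>k\<in>modes N. g k * conv N a b (- k)) = triads N (\<lambda>i j l. g l * (a i * b j))"
proof -
  have "(\<Sum>k\<in>modes N. g k * conv N a b (- k)) =
      (\<Sum>k\<in>modes N. \<Sum>i\<in>modes N. \<Sum>j\<in>modes N. if i + j + k = 0 then g k * (a i * b j) else 0)"
    unfolding conv_def sum_distrib_left by (intro sum.cong refl) auto
  also have "\<dots> = triads N (\<lambda>i j l. g l * (a i * b j))"
    unfolding triads_def
    by (subst sum.swap, rule sum.cong[OF refl], subst sum.swap, rule refl)
  finally show ?thesis .
qed

definition wiener_norm :: "nat \<Rightarrow> nat \<Rightarrow> (int \<Rightarrow> complex) \<Rightarrow> real" where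
  "wiener_norm N s a = (\<Sum>k\<in>modes N. (1 + \<bar>real_of_int k\<bar>)^s * cmod (a k))"

lemma wiener_norm_nonneg [simp]: "0 \<le> wiener_norm N s a"
  by (simp add: wiener_norm_def sum_nonneg)

lemma wiener_norm_mono: "s \<le> s' \<Longrightarrow> wiener_norm N s a \<le> wiener_norm N s' a"
  unfolding wiener_norm_def by (intro sum_mono mult_right_mono power_increasing) auto

lemma wiener_norm_add_le: "wiener_norm N s (\<lambda>k. a k + b k) \<le> wiener_norm N s a + wiener_norm N s b"
  unfolding wiener_norm_def sum.distrib[symmetric] distrib_left[symmetric]
  by (intro sum_mono mult_left_mono norm_triangle_ineq) auto

text \<open>The weight is submultiplicative, \<open>1 + \<bar>i + j\<bar> \<le> (1 + \<bar>i\<bar>)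
  * (1 + \<bar>j\<bar>)\<close>, and discarding the modes of the product beyond \<open>N\<close> can
  only decrease the norm.\<close>

lemma wiener_norm_conv_le: "wiener_norm N s (conv N a b) \<le> wiener_norm N s a * wiener_norm N s b"
proof -
  define w where "w k = (1 + \<bar>real_of_int k\<bar>)^s" for k
  have w0: "w k \<ge> 0" for k by (simp add: w_def)
  have sub: "w (i + j) \<le> w i * w j" for i j
  proof -
    have "1 + \<bar>real_of_int (i + j)\<bar> \<le> 1 + (\<bar>real_of_int i\<bar> + \<bar>real_of_int j\<bar>)" by simp
    also have "\<dots> \<le> (1 + \<bar>real_of_int i\<bar>) * (1 + \<bar>real_of_int j\<bar>)" by (simp add: algebra_simps)
    finally show ?thesis unfolding w_def power_mult_distrib[symmetric] by (intro power_mono) auto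
  qed
  have "wiener_norm N s (conv N a b) \<le>
      (\<Sum>k\<in>modes N. \<Sum>i\<in>modes N. \<Sum>j\<in>modes N. if i + j = k then (w i * cmod (a i)) * (w j * cmod (b j)) else 0)"
    unfolding wiener_norm_def w_def[symmetric]
  proof (rule sum_mono)
    fix k
    have "w k * cmod (conv N a b k) \<le> w k * (\<Sum>i\<in>modes N. \<Sum>j\<in>modes N. cmod (if i + j = k then a i * b j else 0))"
      unfolding conv_def by (intro mult_left_mono w0 order_trans[OF norm_sum] sum_mono order_refl)
    also have "\<dots> \<le> (\<Sum>i\<in>modes N. \<Sum>j\<in>modes N. if i + j = k then (w i * cmod (a i)) * (w j * cmod (b j)) else 0)"
      unfolding sum_distrib_left
    proof (intro sum_mono)
      fix i j
      show "w k * cmod (if i + j = k then a i * b j else 0)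
          \<le> (if i + j = k then (w i * cmod (a i)) * (w j * cmod (b j)) else 0)"
        using mult_right_mono[OF sub[of i j], of "cmod (a i) * cmod (b j)"] by (auto simp: norm_mult ac_simps)
    qed
    finally show "w k * cmod (conv N a b k) \<le> \<dots>" .
  qed
  also have "\<dots> = (\<Sum>i\<in>modes N. \<Sum>j\<in>modes N. \<Sum>k\<in>modes N. if i + j = k then (w i * cmod (a i)) * (w j * cmod (b j)) else 0)"
    by (subst sum.swap, rule sum.cong[OF refl], subst sum.swap, rule refl)
  also have "\<dots> \<le> (\<Sum>i\<in>modes N. \<Sum>j\<in>modes N. (w i * cmod (a i)) * (w j * cmod (b j)))"
    by (intro sum_mono) (simp add: w0 sum.delta)
  also have "\<dots> = wiener_norm N s a * wiener_norm N s b"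
    unfolding wiener_norm_def w_def[symmetric] sum_product ..
  finally show ?thesis .
qed

text \<open>In Fourier variables the semidiscrete equation reads \<open>c' = quad c c + disp c\<close>, where \<open>quad\<close> stands
  for \<open>-(a b)\<^sub>x / 2\<close> and \<open>disp\<close> for \<open>-a\<^sub>x\<^sub>x\<^sub>x + a\<^sub>x\<^sub>x\<^sub>x\<^sub>x\<^sub>x\<close>.\<close>

definition quad :: "nat \<Rightarrow> (int \<Rightarrow> complex) \<Rightarrow> (int \<Rightarrow> complex) \<Rightarrow> int \<Rightarrow> complex" where
  "quad N a b k = - (\<i> * of_int k / 2) * conv N a b k"

definition disp :: "(int \<Rightarrow> complex) \<Rightarrow> int \<Rightarrow> complex" where
  "disp a k = \<i> * of_int (k^3 + k^5) * a k"

lemma wiener_norm_quad_le: "wiener_norm N s (quad N a b) \<le> wiener_norm N (Suc s) a * wiener_norm N (Suc s) b"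
proof -
  have "wiener_norm N s (quad N a b) \<le> wiener_norm N (Suc s) (conv N a b)"
    unfolding wiener_norm_def
  proof (rule sum_mono)
    fix k
    have "\<bar>real_of_int k\<bar> / 2 * cmod (conv N a b k) \<le> (1 + \<bar>real_of_int k\<bar>) * cmod (conv N a b k)"
      by (intro mult_right_mono) auto
    then show "(1 + \<bar>real_of_int k\<bar>)^s * cmod (quad N a b k) \<le> (1 + \<bar>real_of_int k\<bar>)^(Suc s) * cmod (conv N a b k)"
      unfolding quad_def by (simp add: norm_mult norm_divide mult_left_mono mult.assoc mult.left_commute[of "(_ + _)" "_^s"])
  qed
  also have "\<dots> \<le> wiener_norm N (Suc s) a * wiener_norm N (Suc s) b" by (rule wiener_norm_conv_le)
  finally show ?thesis .
qed

lemma wiener_norm_disp_le: "wiener_norm N s (disp a) \<le> 2 * wiener_norm N (s + 5) a"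
  unfolding wiener_norm_def sum_distrib_left
proof (rule sum_mono)
  fix k
  define x where "x = 1 + \<bar>real_of_int k\<bar>"
  have "\<bar>real_of_int k\<bar>^3 \<le> x^3" "x^3 \<le> x^5" "\<bar>real_of_int k\<bar>^5 \<le> x^5"
    unfolding x_def by (intro power_mono power_increasing; simp)+
  then have "cmod (of_int (k^3 + k^5)) \<le> 2 * x^5"
    using abs_triangle_ineq[of "real_of_int k^3" "real_of_int k^5"]
    by (subst norm_of_int) (simp add: power_abs)
  then have "x^s * (cmod (of_int (k^3 + k^5)) * cmod (a k)) \<le> x^s * (2 * x^5 * cmod (a k))"
    by (intro mult_left_mono mult_right_mono) (auto simp: x_def)
  then show "(1 + \<bar>real_of_int k\<bar>)^s * cmod (disp a k) \<le> 2 * ((1 + \<bar>real_of_int k\<bar>)^(s+5) * cmod (a k))"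
    unfolding disp_def x_def[symmetric] by (simp add: norm_mult power_add ac_simps)
qed

section \<open>Conservation laws and Sobolev bounds\<close>

lemma gronwall_exp:
  fixes y y' :: "real \<Rightarrow> real"
  assumes der: "\<And>t. 0 \<le> t \<Longrightarrow> (y has_vector_derivative y' t) (at t within {0..})"
    and le: "\<And>t. 0 \<le> t \<Longrightarrow> y' t \<le> K * y t" and t: "0 \<le> t"
  shows "y t \<le> y 0 * exp (K * t)"
proof (cases "t = 0")
  case False
  with t have t: "0 < t" by simp
  define g where "g s = y s * exp (- K * s)" for s
  have "(g has_derivative (\<lambda>h. (y' s - K * y s) * exp (- K * s) * h)) (at s within {0..t})"
    if "s \<in> {0..t}" for s
  proof -
    have "(y has_real_derivative y' s) (at s within {0..t})"
      using der[of s] that has_vector_derivative_within_subset[of y "y' s" s "{0..}" "{0..t}"]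
      by (auto simp: has_real_derivative_iff_has_vector_derivative)
    then have "(g has_real_derivative (y' s - K * y s) * exp (- K * s)) (at s within {0..t})"
      unfolding g_def by (auto intro!: derivative_eq_intros simp: algebra_simps)
    then show ?thesis by (simp add: has_field_derivative_def mult.commute[of "(y' s - K * y s) * exp (- K * s)"] fun_eq_iff)
  qed
  from mvt_simple[OF t this] obtain s where "s \<in> {0<..<t}"
    "g t - g 0 = (y' s - K * y s) * exp (- K * s) * (t - 0)" by auto
  moreover have "(y' s - K * y s) * exp (- K * s) * (t - 0) \<le> 0"
    using le[of s] \<open>s \<in> _\<close> t by (intro mult_nonpos_nonneg) auto
  ultimately have "y t * exp (- K * t) \<le> y 0" by (simp add: g_def)
  then have "y t * exp (- K * t) * exp (K * t) \<le> y 0 * exp (K * t)"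
    by (intro mult_right_mono) auto
  then show ?thesis by (simp add: mult.assoc exp_add[symmetric])
qed simp

lemma increment_bound:
  fixes f f' :: "real \<Rightarrow> 'a::real_normed_vector"
  assumes "\<And>t. t \<in> {a..a + h} \<Longrightarrow> (f has_vector_derivative f' t) (at t within {a..a + h})"
    and bound: "\<And>t. t \<in> {a..a + h} \<Longrightarrow> norm (f' t) \<le> B" and t: "t \<in> {a..a + h}"
  shows "norm (f t - f a) \<le> B * h"
proof -
  have a: "a \<in> {a..a + h}" using t by simp
  have "norm (f t - f a) \<le> B * norm (t - a)"
    using assms(1,2) by (intro differentiable_bound[OF _ _ _ t a])
      (auto simp: has_vector_derivative_def onorm_scaleR_left[OF bounded_linear_ident] onorm_id)
  moreover have "B \<ge> 0" using bound[OF a] norm_ge_zero order_trans by blast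
  ultimately show ?thesis using t mult_left_mono[of "norm (t - a)" h B] by auto
qed

text \<open>Only one-sided derivatives are available at time \<open>0\<close>, hence two mean value estimates instead of
  Taylor's theorem.\<close>

lemma trapezoid_error:
  fixes g :: "real \<Rightarrow> complex"
  assumes d1: "\<And>t. 0 \<le> t \<Longrightarrow> (g has_vector_derivative g1 t) (at t within {0..})"
    and d2: "\<And>t. 0 \<le> t \<Longrightarrow> (g1 has_vector_derivative g2 t) (at t within {0..})"
    and d3: "\<And>t. 0 \<le> t \<Longrightarrow> (g2 has_vector_derivative g3 t) (at t within {0..})"
    and bound: "\<And>t. t \<in> {a..a + h} \<Longrightarrow> cmod (g3 t) \<le> K" and "0 \<le> a" "0 \<le> h"
  shows "cmod (g (a + h) - g a - (h / 2) *\<^sub>R (g1 a + g1 (a + h))) \<le> K * h^3"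
proof -
  define S where "S = {a..a + h}"
  have K: "K \<ge> 0" using order_trans[OF norm_ge_zero bound[of a]] \<open>0 \<le> h\<close> by simp
  have sub: "S \<subseteq> {0..}" and hS: "a + h \<in> S"
    using \<open>0 \<le> a\<close> \<open>0 \<le> h\<close> by (auto simp: S_def)
  note within = has_vector_derivative_within_subset[OF _ sub]
  have e1: "(g has_vector_derivative g1 t) (at t within S)"
    and e2: "(g1 has_vector_derivative g2 t) (at t within S)"
    and e3: "(g2 has_vector_derivative g3 t) (at t within S)" if "t \<in> S" for t
    using that sub by (auto intro!: within d1 d2 d3)
  \<comment> \<open>\<open>p\<close> is the trapezoidal error on \<open>[a, t]\<close> and
    \<open>q\<close> its derivative; both vanish at \<open>a\<close>. The second derivatives of
    \<open>g\<close> cancel in \<open>q'\<close>, leaving \<open>g3\<close> times a factor of size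
    at most \<open>h\<close>, so two mean value estimates give \<open>h^3\<close>.\<close>
  define p where "p t = g t - g a - ((t - a) / 2) *\<^sub>R (g1 a + g1 t)" for t
  define q where "q t = (1/2) *\<^sub>R (g1 t - g1 a) - ((t - a) / 2) *\<^sub>R g2 t" for t
  have p': "(p has_vector_derivative q t) (at t within S)" if "t \<in> S" for t
    unfolding p_def q_def
    by (rule derivative_eq_intros e1[OF that] e2[OF that] refl | simp add: algebra_simps scaleR_add_left[symmetric])+
  have q': "(q has_vector_derivative - ((t - a) / 2) *\<^sub>R g3 t) (at t within S)" if "t \<in> S" for t
    unfolding q_def
    by (rule derivative_eq_intros e3[OF that] e2[OF that] refl | simp add: algebra_simps scaleR_add_left[symmetric])+
  have qb: "norm (q t) \<le> (h * K) * h" if "t \<in> S" for t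
  proof -
    have "norm (- ((t - a) / 2) *\<^sub>R g3 t) \<le> h * K" if "t \<in> S" for t
      unfolding norm_scaleR using that bound[of t] K by (intro mult_mono) (auto simp: S_def)
    from increment_bound[OF q'[unfolded S_def] this[unfolded S_def] that[unfolded S_def]] show ?thesis by (simp add: q_def)
  qed
  from increment_bound[OF p'[unfolded S_def] qb[unfolded S_def] hS[unfolded S_def]] have "norm (p (a + h)) \<le> h * K * h * h" by (simp add: p_def)
  then show ?thesis by (simp add: p_def power3_eq_cube ac_simps)
qed

section \<open>The Galerkin system and its conserved quantities\<close>

text \<open>Coefficients outside \<open>modes N\<close> are left unconstrained: the instance used
  later is \<open>dft N (U t)\<close>, which beyond \<open>modes N\<close> continues periodically by
  aliasing instead of vanishing.\<close>

locale galerkin =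
  fixes N :: nat and c :: "real \<Rightarrow> int \<Rightarrow> complex"
  assumes reality: "\<And>t k. 0 \<le> t \<Longrightarrow> k \<in> modes N \<Longrightarrow> c t (- k) = cnj (c t k)"
    and ode: "\<And>t k. 0 \<le> t \<Longrightarrow> k \<in> modes N \<Longrightarrow>
      ((\<lambda>s. c s k) has_vector_derivative quad N (c t) (c t) k + disp (c t) k) (at t within {0..})"
begin

definition rate :: "real \<Rightarrow> int \<Rightarrow> complex" where
  "rate t k = quad N (c t) (c t) k + disp (c t) k"

lemmas ode' = ode[folded rate_def]

text \<open>Pairing with the conjugate removes the dispersion, since its symbol is imaginary. By
  reality the conjugate is the coefficient at \<open>- k\<close>, and evenness of \<open>w\<close>
  allows the reflection that brings the nonlinear part into resonant form.\<close>

lemma weighted_sum_rate: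
  assumes t: "0 \<le> t" and even: "\<And>k. w (- k) = w k"
  shows "(\<Sum>k\<in>modes N. w k * (2 * Re (rate t k * cnj (c t k)))) =
    Re (\<i> * triads N (\<lambda>i j l. of_real (w l * of_int l) * (c t i * c t j * c t l)))"
proof -
  have "(\<Sum>k\<in>modes N. w k * (2 * Re (rate t k * cnj (c t k)))) =
      Re (\<Sum>k\<in>modes N. (- \<i> * of_real (w k * of_int k) * c t (- k)) * conv N (c t) (c t) k)"
    unfolding Re_sum
  proof (rule sum.cong[OF refl])
    fix k assume "k \<in> modes N"
    have "Re (disp (c t) k * cnj (c t k)) = 0"
      unfolding disp_def mult.assoc complex_norm_square[symmetric] by (simp del: of_real_power)
    then have "w k * (2 * Re (rate t k * cnj (c t k))) = Re (of_real (2 * w k) * (quad N (c t) (c t) k * cnj (c t k)))"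
      unfolding rate_def by (simp add: distrib_right)
    also have "of_real (2 * w k) * (quad N (c t) (c t) k * cnj (c t k))
       = (- \<i> * of_real (w k * of_int k) * c t (- k)) * conv N (c t) (c t) k"
      by (simp add: quad_def reality[OF t \<open>k \<in> modes N\<close>])
    finally show "w k * (2 * Re (rate t k * cnj (c t k))) =
       Re ((- \<i> * of_real (w k * of_int k) * c t (- k)) * conv N (c t) (c t) k)" .
  qed
  also have "(\<Sum>k\<in>modes N. (- \<i> * of_real (w k * of_int k) * c t (- k)) * conv N (c t) (c t) k)
      = (\<Sum>k\<in>modes N. (\<i> * of_real (w k * of_int k) * c t k) * conv N (c t) (c t) (- k))"
    by (subst sum_modes_uminus[symmetric]) (simp add: even)
  also have "\<dots> = \<i> * triads N (\<lambda>i j l. of_real (w l * of_int l) * (c t i * c t j * c t l))"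
    unfolding sum_conv_eq_triads triads_mult_left[symmetric] by (rule triads_cong) (simp add: ac_simps)
  finally show ?thesis .
qed

lemma weighted_sum_derivative:
  assumes t: "0 \<le> t"
  shows "((\<lambda>s. \<Sum>k\<in>modes N. w k * (cmod (c s k))\<^sup>2) has_vector_derivative
    (\<Sum>k\<in>modes N. w k * (2 * Re (rate t k * cnj (c t k))))) (at t within {0..})"
proof (rule has_vector_derivative_sum)
  fix k assume k: "k \<in> modes N"
  note d = ode'[OF t k]
  have "((\<lambda>s. Re (c s k * cnj (c s k))) has_vector_derivative
      Re (c t k * cnj (rate t k) + rate t k * cnj (c t k))) (at t within {0..})"
    by (intro bounded_linear.has_vector_derivative[OF bounded_linear_Re] has_vector_derivative_mult
        bounded_linear.has_vector_derivative[OF bounded_linear_cnj] d)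
  then have "((\<lambda>s. (cmod (c s k))\<^sup>2) has_vector_derivative 2 * Re (rate t k * cnj (c t k))) (at t within {0..})"
    unfolding cmod_power2 by (simp add: power2_eq_square mult.commute)
  then show "((\<lambda>s. w k * (cmod (c s k))\<^sup>2) has_vector_derivative w k * (2 * Re (rate t k * cnj (c t k)))) (at t within {0..})"
    by (rule bounded_linear.has_vector_derivative[OF bounded_linear_mult_right])
qed

text \<open>Squared homogeneous Sobolev seminorm, up to the factor \<open>2 * pi\<close>. For
  \<open>s = 0\<close> it is the whole mass, the mode \<open>k = 0\<close> included, because
  \<open>0 ^ 0 = 1\<close>.\<close>

definition energy :: "nat \<Rightarrow> real \<Rightarrow> real" where
  "energy s t = (\<Sum>k\<in>modes N. (of_int k)^(2 * s) * (cmod (c t k))\<^sup>2)"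

definition cubic :: "real \<Rightarrow> complex" where
  "cubic t = triads N (\<lambda>i j l. c t i * c t j * c t l)"

definition energy_rate :: "nat \<Rightarrow> real \<Rightarrow> real" where
  "energy_rate s t = Re (\<i> * triads N (\<lambda>i j l. of_real (of_int l^(2 * s + 1)) * (c t i * c t j * c t l)))"

lemma energy_derivative:
  assumes t: "0 \<le> t"
  shows "(energy s has_vector_derivative energy_rate s t) (at t within {0..})"
proof -
  have "(\<Sum>k\<in>modes N. real_of_int k^(2 * s) * (2 * Re (rate t k * cnj (c t k)))) = energy_rate s t"
    unfolding energy_rate_def by (subst weighted_sum_rate[OF t]) (simp_all add: power_minus_even mult.commute)
  then show ?thesis
    using weighted_sum_derivative[OF t, of "\<lambda>k. real_of_int k^(2 * s)"] by (simp add: energy_def[abs_def])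
qed

text \<open>The cubic monomial is invariant under permutations, so only the symmetrised symbol
  matters; the cancellation between large frequencies is visible in this form only.\<close>

lemma energy_rate_symmetric:
  "3 * energy_rate s t = Re (\<i> * triads N (\<lambda>i j l.
     of_real (of_int i^(2 * s + 1) + of_int j^(2 * s + 1) + of_int l^(2 * s + 1)) * (c t i * c t j * c t l)))"
proof -
  define f where "f i j l = of_real (of_int l^(2 * s + 1)) * (c t i * c t j * c t l)" for i j l
  have "triads N (\<lambda>i j l. of_real (of_int i^(2 * s + 1) + of_int j^(2 * s + 1) + of_int l^(2 * s + 1)) * (c t i * c t j * c t l))
     = triads N (\<lambda>i j l. (f l j i + f i l j) + f i j l)"
    by (rule triads_cong) (simp add: f_def algebra_simps)
  also have "\<dots> = 3 * triads N f"
    unfolding triads_add triads_swap13[of N f] triads_swap23[of N f] by simp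
  finally show ?thesis by (simp add: energy_rate_def f_def[abs_def])
qed

text \<open>For \<open>s = 0\<close> the symmetrised symbol is \<open>i + j + l\<close>, which
  vanishes on resonant triads.\<close>

lemma mass_conserved:
  assumes "0 \<le> t"
  shows "energy 0 t = energy 0 0"
proof -
  have r0: "energy_rate 0 s = 0" for s
  proof -
    have "3 * energy_rate 0 s = Re (\<i> * triads N (\<lambda>i j l. 0 * c s 0))"
      unfolding energy_rate_symmetric
      by (intro arg_cong[of _ _ "\<lambda>z. Re (\<i> * z)"] triads_cong)
        (simp add: of_int_add[symmetric] del: of_int_add)
    then show ?thesis unfolding triads_mult_left by simp
  qed
  have "(energy 0 has_vector_derivative 0) (at s within {0..})" if "s \<in> {0..}" for s
    using energy_derivative[of s 0] that by (simp add: r0)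
  then obtain a where "\<And>x. x \<in> {0..} \<Longrightarrow> energy 0 x = a"
    using has_vector_derivative_zero_constant[of "{0..}" "energy 0"] by auto
  with assms show ?thesis by auto
qed

text \<open>The three slots contribute equally. In the nonlinear part
  \<open>l * conv l * conv (- l)\<close> is odd in \<open>l\<close> and sums to zero; this survives
  the truncation because both factors are cut at the same modes. The dispersive part has the symbol
  \<open>l^3 + l^5\<close>, the combined rate of \<open>energy 1\<close> and
  \<open>energy 2\<close>, which fixes the coefficient 1/3 in the Hamiltonian.\<close>

lemma cubic_derivative:
  assumes t: "0 \<le> t"
  shows "(cubic has_vector_derivative 3 * (\<i> * triads N (\<lambda>i j l.
    of_real (of_int l^(2 * 1 + 1) + of_int l^(2 * 2 + 1)) * (c t i * c t j * c t l)))) (at t within {0..})"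
proof -
  define f where "f i j l = rate t l * (c t i * c t j)" for i j l
  have "(cubic has_vector_derivative triads N (\<lambda>i j l. (f l j i + f i l j) + f i j l)) (at t within {0..})"
    unfolding cubic_def[abs_def] triads_def
  proof (intro has_vector_derivative_sum)
    fix i j l assume "i \<in> modes N" "j \<in> modes N" "l \<in> modes N"
    note d = ode'[OF t this(1)] ode'[OF t this(2)] ode'[OF t this(3)]
    show "((\<lambda>s. if i + j + l = 0 then c s i * c s j * c s l else 0) has_vector_derivative
        (if i + j + l = 0 then (f l j i + f i l j) + f i j l else 0)) (at t within {0..})"
      by (auto intro!: derivative_eq_intros d simp: f_def algebra_simps)
  qed
  also have "triads N (\<lambda>i j l. (f l j i + f i l j) + f i j l) = 3 * triads N f"
    unfolding triads_add triads_swap13[of N f] triads_swap23[of N f] by simp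
  also have "triads N f = (\<Sum>l\<in>modes N. rate t l * conv N (c t) (c t) (- l))"
    unfolding sum_conv_eq_triads f_def ..
  also have "\<dots> = (\<Sum>l\<in>modes N. quad N (c t) (c t) l * conv N (c t) (c t) (- l)) +
      (\<Sum>l\<in>modes N. disp (c t) l * conv N (c t) (c t) (- l))"
    unfolding rate_def distrib_right sum.distrib ..
  also have "(\<Sum>l\<in>modes N. quad N (c t) (c t) l * conv N (c t) (c t) (- l)) = 0"
  proof -
    let ?S = "\<Sum>l\<in>modes N. quad N (c t) (c t) l * conv N (c t) (c t) (- l)"
    have "?S = (\<Sum>l\<in>modes N. quad N (c t) (c t) (- l) * conv N (c t) (c t) (- (- l)))"
      by (rule sum_modes_uminus[symmetric])
    also have "\<dots> = - ?S"
      unfolding sum_negf[symmetric] by (intro sum.cong refl) (simp add: quad_def)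
    finally show ?thesis by simp
  qed
  also have "(\<Sum>l\<in>modes N. disp (c t) l * conv N (c t) (c t) (- l)) =
      \<i> * triads N (\<lambda>i j l. of_real (of_int l^(2 * 1 + 1) + of_int l^(2 * 2 + 1)) * (c t i * c t j * c t l))"
    unfolding sum_conv_eq_triads triads_mult_left[symmetric] disp_def
    by (rule triads_cong) (simp add: ac_simps numeral_3_eq_3 eval_nat_numeral)
  finally show ?thesis by simp
qed

lemma hamiltonian_conserved:
  assumes "0 \<le> t"
  shows "energy 1 t + energy 2 t - Re (cubic t) / 3 = energy 1 0 + energy 2 0 - Re (cubic 0) / 3"
proof -
  have "((\<lambda>t. energy 1 t + energy 2 t - Re (cubic t) / 3) has_vector_derivative 0) (at s within {0..})"
    if "s \<in> {0..}" for s
  proof -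
    let ?D = "3 * (\<i> * triads N (\<lambda>i j l.
       of_real (of_int l^(2 * 1 + 1) + of_int l^(2 * 2 + 1)) * (c s i * c s j * c s l)))"
    have "((\<lambda>t. energy 1 t + energy 2 t - Re (cubic t) / 3) has_vector_derivative
        energy_rate 1 s + energy_rate 2 s - Re ?D / 3) (at s within {0..})"
      using that
      by (intro has_vector_derivative_add has_vector_derivative_diff energy_derivative has_vector_derivative_divide
        bounded_linear.has_vector_derivative[OF bounded_linear_Re] cubic_derivative) auto
    moreover have "energy_rate 1 s + energy_rate 2 s - Re ?D / 3 = 0"
      unfolding energy_rate_def of_real_add distrib_right triads_add distrib_left by simp
    ultimately show ?thesis by simp
  qed
  then obtain a where "\<And>x. x \<in> {0..} \<Longrightarrow> energy 1 x + energy 2 x - Re (cubic x) / 3 = a"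
    using has_vector_derivative_zero_constant[of "{0..}" "\<lambda>t. energy 1 t + energy 2 t - Re (cubic t) / 3"] by auto
  with assms show ?thesis by auto
qed

end

section \<open>Constants, differentiation rules and duality\<close>

definition loss :: "nat \<Rightarrow> real" where
  "loss s = 1 + real (2 * s + 1) * 2^s"

text \<open>The root of \<open>5 * (8 * R + 4 * R^2)\<close>: the 5 comes from
  \<open>l1_le_sobolev\<close>, the bracket bounds \<open>energy 1 + energy 2\<close> by the
  Hamiltonian and the mass.\<close>

definition gradient_bound :: "real \<Rightarrow> real" where
  "gradient_bound R = sqrt (40 * R + 20 * R\<^sup>2)"

text \<open>The 5 comes from \<open>l1_le_sobolev\<close> and \<open>2^31\<close> from comparing
  weights; the two terms in \<open>R\<close> bound the conserved mass and the growing
  \<open>energy 16\<close>.\<close>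

definition wiener_bound :: "real \<Rightarrow> real \<Rightarrow> real" where
  "wiener_bound R T = sqrt (5 * 2^31 * (R + R * exp (loss 16 * gradient_bound R * T)))"

lemma quad_has_vector_derivative:
  assumes a: "\<And>k. k \<in> modes N \<Longrightarrow> ((\<lambda>s. a s k) has_vector_derivative a' k) (at t within S)"
    and b: "\<And>k. k \<in> modes N \<Longrightarrow> ((\<lambda>s. b s k) has_vector_derivative b' k) (at t within S)"
  shows "((\<lambda>s. quad N (a s) (b s) k) has_vector_derivative quad N a' (b t) k + quad N (a t) b' k) (at t within S)"
proof -
  have "((\<lambda>s. conv N (a s) (b s) k) has_vector_derivative (\<Sum>i\<in>modes N. \<Sum>j\<in>modes N. if i + j = k then a t i * b' j + a' i * b t j else 0)) (at t within S)"
    unfolding conv_def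
  proof (intro has_vector_derivative_sum)
    fix i j assume "i \<in> modes N" "j \<in> modes N"
    then show "((\<lambda>s. if i + j = k then a s i * b s j else 0) has_vector_derivative
        (if i + j = k then a t i * b' j + a' i * b t j else 0)) (at t within S)"
      by (auto intro: has_vector_derivative_mult a b)
  qed
  also have "(\<Sum>i\<in>modes N. \<Sum>j\<in>modes N. if i + j = k then a t i * b' j + a' i * b t j else 0)
      = conv N a' (b t) k + conv N (a t) b' k"
    unfolding conv_def sum.distrib[symmetric] by (intro sum.cong refl) auto
  finally show ?thesis
    unfolding quad_def distrib_left[symmetric]
    by (rule bounded_linear.has_vector_derivative[OF bounded_linear_mult_right])
qed

lemma disp_has_vector_derivative:
  assumes "((\<lambda>s. a s k) has_vector_derivative a' k) (at t within S)"
  shows "((\<lambda>s. disp (a s) k) has_vector_derivative disp a' k) (at t within S)"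
  unfolding disp_def using assms by (rule bounded_linear.has_vector_derivative[OF bounded_linear_mult_right])

text \<open>The parallelogram identity of a quadratic map. Averaging the rates and taking the rate
  of the average thus differ only by a quadratic expression in the increment.\<close>

lemma trapezoid_quad:
  "(quad N a a k + quad N b b k) / 2 - quad N (\<lambda>i. (a i + b i) / 2) (\<lambda>i. (a i + b i) / 2) k
    = quad N (\<lambda>i. b i - a i) (\<lambda>i. b i - a i) k / 4"
proof -
  have "(conv N a a k + conv N b b k) / 2 - conv N (\<lambda>i. (a i + b i) / 2) (\<lambda>i. (a i + b i) / 2) k
    = conv N (\<lambda>i. b i - a i) (\<lambda>i. b i - a i) k / 4"
    unfolding conv_def sum_divide_distrib sum.distrib[symmetric] sum_subtractf[symmetric]
    by (intro sum.cong refl) (auto simp: field_simps)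
  moreover have "(p * x + p * y) / 2 - p * z = p * u / 4" if "(x + y) / 2 - z = u / 4" for p x y z u :: complex
    using arg_cong[OF that, of "\<lambda>v. p * v"] by (simp add: algebra_simps add_divide_distrib)
  ultimately show ?thesis unfolding quad_def by blast
qed

text \<open>A norming functional, built from the weight and the conjugate phases. Applied to the
  coefficients it produces a complex-valued function of time, for which the scalar estimates
  suffice.\<close>

lemma wiener_norm_dual:
  obtains w where "\<And>b. cmod (\<Sum>k\<in>modes N. w k * b k) \<le> wiener_norm N s b"
    "cmod (\<Sum>k\<in>modes N. w k * a k) = wiener_norm N s a"
proof
  define w where "w k = of_real ((1 + \<bar>real_of_int k\<bar>)^s) * cnj (sgn (a k))" for k
  have w: "cmod (w k) \<le> (1 + \<bar>real_of_int k\<bar>)^s" for k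
    unfolding w_def norm_mult norm_of_real complex_mod_cnj norm_sgn by simp
  show "cmod (\<Sum>k\<in>modes N. w k * b k) \<le> wiener_norm N s b" for b
    unfolding wiener_norm_def
    by (rule order_trans[OF norm_sum]) (auto simp: norm_mult intro!: sum_mono mult_right_mono w)
  have "w k * a k = of_real ((1 + \<bar>real_of_int k\<bar>)^s * cmod (a k))" for k
  proof -
    have "cnj (sgn z) * z = of_real (cmod z)" for z
    proof (cases "z = 0")
      case False
      have "cnj z * z = of_real (cmod z) * of_real (cmod z)"
        using complex_norm_square[of z] by (simp only: power2_eq_square of_real_mult mult.commute)
      moreover have "cnj (sgn z) * z = (cnj z * z) / of_real (cmod z)" by (simp add: sgn_eq)
      ultimately show ?thesis using False by (simp only: nonzero_mult_div_cancel_right of_real_eq_0_iff norm_eq_zero not_False_eq_True)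
    qed simp
    then show ?thesis unfolding w_def of_real_mult by (simp add: mult.assoc)
  qed
  then have "(\<Sum>k\<in>modes N. w k * a k) = of_real (wiener_norm N s a)"
    unfolding wiener_norm_def by simp
  then show "cmod (\<Sum>k\<in>modes N. w k * a k) = wiener_norm N s a" by simp
qed

section \<open>Bounds uniform in the number of modes\<close>

context galerkin begin

definition gradient_norm :: "real \<Rightarrow> real" where
  "gradient_norm t = (\<Sum>k\<in>modes N. \<bar>real_of_int k\<bar> * cmod (c t k))"

lemma gradient_norm_nonneg: "0 \<le> gradient_norm t"
  by (simp add: gradient_norm_def sum_nonneg)

lemma energy_nonneg: "0 \<le> energy s t"
  unfolding energy_def by (intro sum_nonneg mult_nonneg_nonneg) (auto simp: zero_le_even_power)

text \<open>One derivative falls on one slot, measured in \<open>l^1\<close>, and \<open>s\<close>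
  derivatives fall on each of the other two, measured in \<open>l^2\<close>. The three permutations
  have equal sums, which cancels the 3 of the symmetrisation.\<close>

lemma energy_rate_le: "energy_rate s t \<le> loss s * gradient_norm t * energy s t"
proof -
  define \<alpha> where "\<alpha> k = \<bar>real_of_int k\<bar> * cmod (c t k)" for k
  define \<beta> where "\<beta> k = \<bar>real_of_int k\<bar>^s * cmod (c t k)" for k
  define f where "f i j l = \<alpha> i * (\<beta> j * \<beta> l)" for i j l
  define F where "F = triads N (\<lambda>i j l.
     of_real (of_int i^(2 * s + 1) + of_int j^(2 * s + 1) + of_int l^(2 * s + 1)) * (c t i * c t j * c t l))"
  have "norm F \<le> triads N (\<lambda>i j l. loss s * (f i j l + f j i l + f l j i))"
    unfolding F_def
  proof (rule norm_triads_le)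
    fix i j l :: int assume "i + j + l = 0"
    then have "real_of_int i + of_int j + of_int l = 0" by (simp add: of_int_add[symmetric] del: of_int_add)
    from mult_right_mono[OF abs_odd_power_sum[OF this, of s], of "cmod (c t i * c t j * c t l)"]
    show "norm (of_real (of_int i^(2 * s + 1) + of_int j^(2 * s + 1) + of_int l^(2 * s + 1)) * (c t i * c t j * c t l))
      \<le> loss s * (f i j l + f j i l + f l j i)"
      unfolding norm_mult norm_of_real loss_def f_def \<alpha>_def \<beta>_def by (simp add: algebra_simps)
  qed
  also have "\<dots> = loss s * (3 * triads N f)"
    unfolding triads_mult_left triads_add triads_swap12[of N f] triads_swap13[of N f] by simp
  also have "\<dots> \<le> loss s * (3 * (gradient_norm t * energy s t))"
  proof -
    have "triads N f \<le> (\<Sum>k\<in>modes N. \<alpha> k) * (\<Sum>k\<in>modes N. (\<beta> k)\<^sup>2)"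
      unfolding f_def by (rule triads_le_l1_l2) (simp add: \<alpha>_def)
    also have "(\<Sum>k\<in>modes N. (\<beta> k)\<^sup>2) = energy s t"
    proof -
      have "(\<bar>x\<bar>^s)\<^sup>2 = x^(2 * s)" for x :: real
        by (simp only: power_mult[symmetric] mult.commute[of s 2]) (simp only: power_mult power2_abs)
      then show ?thesis unfolding energy_def \<beta>_def power_mult_distrib by simp
    qed
    finally show ?thesis unfolding \<alpha>_def gradient_norm_def[symmetric] loss_def
      by (intro mult_left_mono) auto
  qed
  finally have "norm F \<le> 3 * (loss s * gradient_norm t * energy s t)" by (simp add: ac_simps)
  moreover have "3 * energy_rate s t \<le> norm F"
    unfolding energy_rate_symmetric F_def[symmetric]
    using complex_Re_le_cmod[of "\<i> * F"] by (simp add: norm_mult)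
  ultimately show ?thesis by linarith
qed

lemma norm_cubic_le: "norm (cubic t) / 3 \<le> (energy 0 t + energy 1 t + energy 2 t) / 2 + (energy 0 t)\<^sup>2"
proof -
  define S where "S = (\<Sum>k\<in>modes N. cmod (c t k))"
  have "norm (cubic t) \<le> triads N (\<lambda>i j l. cmod (c t i) * (cmod (c t j) * cmod (c t l)))"
    unfolding cubic_def by (rule norm_triads_le) (simp add: norm_mult)
  also have "\<dots> \<le> S * energy 0 t"
    unfolding S_def energy_def using triads_le_l1_l2[of "\<lambda>k. cmod (c t k)" N "\<lambda>k. cmod (c t k)"] by simp
  finally have "norm (cubic t) \<le> S * energy 0 t" .
  moreover have "S\<^sup>2 \<le> 5 * (energy 0 t + energy 1 t)"
    unfolding S_def energy_def sum.distrib[symmetric]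
    by (rule order_trans[OF l1_le_sobolev]) (simp add: distrib_right)
  \<comment> \<open>The weight 1/10 is chosen against the 5 of the embedding: only half of the
    quadratic energy is spent, and the remainder is a power of the conserved mass.\<close>
  moreover have "S * energy 0 t / 3 \<le> S\<^sup>2 / 10 + (energy 0 t)\<^sup>2"
  proof -
    have "0 \<le> (S - (5/3) * energy 0 t)\<^sup>2" by simp
    also have "\<dots> = S\<^sup>2 - (10/3) * (S * energy 0 t) + (25/9) * (energy 0 t)\<^sup>2"
      by (simp add: power2_eq_square algebra_simps)
    finally show ?thesis using zero_le_power2[of "energy 0 t"] by linarith
  qed
  ultimately have "norm (cubic t) / 3 \<le> (5 * (energy 0 t + energy 1 t)) / 10 + (energy 0 t)\<^sup>2"
    by (smt (verit) divide_right_mono)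
  then show ?thesis using energy_nonneg[of 2 t] by (simp add: field_simps)
qed

text \<open>The cubic part of the Hamiltonian is subordinate to the quadratic one because the mass is
  conserved, so the Hamiltonian controls the \<open>H\<^sup>2\<close> norm for all times.\<close>

lemma gradient_norm_le:
  assumes t: "0 \<le> t" and R: "energy 0 0 \<le> R" "energy 1 0 \<le> R" "energy 2 0 \<le> R"
  shows "gradient_norm t \<le> gradient_bound R"
proof -
  define m where "m = energy 0 0"
  have m: "0 \<le> m" "m \<le> R" "m\<^sup>2 \<le> R\<^sup>2"
    using energy_nonneg[of 0 0] R unfolding m_def by (auto intro: power_mono)
  have "energy 1 t + energy 2 t \<le> energy 1 0 + energy 2 0 + norm (cubic t) / 3 + norm (cubic 0) / 3"
    using hamiltonian_conserved[OF t] abs_Re_le_cmod[of "cubic t"] abs_Re_le_cmod[of "cubic 0"]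
    by (simp add: abs_le_iff)
  also have "\<dots> \<le> energy 1 0 + energy 2 0 + ((m + energy 1 t + energy 2 t) / 2 + m\<^sup>2)
      + ((m + energy 1 0 + energy 2 0) / 2 + m\<^sup>2)"
    using norm_cubic_le[of t] norm_cubic_le[of 0] unfolding m_def mass_conserved[OF t] by linarith
  \<comment> \<open>The half of the energies at time \<open>t\<close> on the right is absorbed on
    the left, which doubles all other terms.\<close>
  finally have "energy 1 t + energy 2 t \<le> 3 * (energy 1 0 + energy 2 0) + 2 * m + 4 * m\<^sup>2"
    by (simp add: field_simps)
  then have X: "energy 1 t + energy 2 t \<le> 8 * R + 4 * R\<^sup>2"
    using R(2,3) m(2,3) by argo
  have "(gradient_norm t)\<^sup>2 \<le> 5 * (energy 1 t + energy 2 t)"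
    unfolding gradient_norm_def energy_def sum.distrib[symmetric]
    by (rule order_trans[OF l1_le_sobolev])
      (auto intro!: sum_mono simp: power_mult_distrib power2_eq_square power4_eq_xxxx algebra_simps)
  also have "\<dots> \<le> 40 * R + 20 * R\<^sup>2" using X by simp
  finally show ?thesis unfolding gradient_bound_def by (rule real_le_rsqrt)
qed

lemma energy_growth:
  assumes "\<And>t. 0 \<le> t \<Longrightarrow> gradient_norm t \<le> D" and t: "0 \<le> t" "t \<le> T"
  shows "energy s t \<le> energy s 0 * exp (loss s * D * T)"
proof -
  have l: "loss s \<ge> 0" by (simp add: loss_def)
  have D: "D \<ge> 0" using assms(1)[of 0] gradient_norm_nonneg[of 0] by linarith
  have "energy s t \<le> energy s 0 * exp (loss s * D * t)"
  proof (rule gronwall_exp[OF energy_derivative _ t(1)])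
    fix x :: real assume "0 \<le> x"
    then show "energy_rate s x \<le> loss s * D * energy s x"
      by (intro order_trans[OF energy_rate_le] mult_right_mono mult_left_mono assms(1) l energy_nonneg)
  qed
  also have "\<dots> \<le> energy s 0 * exp (loss s * D * T)"
    using t l D by (intro mult_left_mono energy_nonneg) (auto intro!: mult_left_mono)
  finally show ?thesis .
qed

end

text \<open>From here on all constants are functions of \<open>R\<close> and \<open>T\<close>;
  \<open>R\<close> will be a bound for the initial datum before truncation, hence the same for every
  \<open>N\<close>.\<close>

locale galerkin_sobolev = galerkin +
  fixes R T :: real
  assumes initial: "(\<Sum>k\<in>modes N. (1 + (real_of_int k)\<^sup>2)^16 * (cmod (c 0 k))\<^sup>2) \<le> R"
begin

lemma energy_initial:
  assumes "s \<le> 16"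
  shows "energy s 0 \<le> R"
proof (rule order_trans[OF _ initial], unfold energy_def, intro sum_mono mult_right_mono)
  fix k :: int
  have "(real_of_int k)^(2 * s) \<le> (1 + (real_of_int k)\<^sup>2)^s"
    unfolding power_mult by (intro power_mono) auto
  also have "\<dots> \<le> (1 + (real_of_int k)\<^sup>2)^16" using assms by (intro power_increasing) auto
  finally show "(real_of_int k)^(2 * s) \<le> (1 + (real_of_int k)\<^sup>2)^16" .
qed simp

lemma gradient_norm_bounded: "0 \<le> t \<Longrightarrow> gradient_norm t \<le> gradient_bound R"
  by (rule gradient_norm_le) (auto intro: energy_initial)

lemma wiener_norm_bounded:
  assumes t: "0 \<le> t" "t \<le> T"
  shows "wiener_norm N 15 (c t) \<le> wiener_bound R T"
proof -
  have "(wiener_norm N 15 (c t))\<^sup>2 \<le> 5 * (\<Sum>k\<in>modes N. (1 + (real_of_int k)\<^sup>2) * ((1 + \<bar>real_of_int k\<bar>)^15 * cmod (c t k))\<^sup>2)"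
    unfolding wiener_norm_def by (rule l1_le_sobolev)
  also have "\<dots> \<le> 5 * (\<Sum>k\<in>modes N. 2^31 * ((real_of_int k^(2 * 0) + real_of_int k^(2 * 16)) * (cmod (c t k))\<^sup>2))"
  proof (intro mult_left_mono sum_mono)
    fix k :: int
    define x where "x = (real_of_int k)\<^sup>2"
    have x: "x \<ge> 0" by (simp add: x_def)
    \<comment> \<open>The fifteenth power of this comparison gives \<open>2^15\<close>, and
      \<open>(1 + x)^16 \<le> 2^16 * (1 + x^16)\<close> the remaining factor; the two homogeneous
      energies 0 and 16 then suffice.\<close>
    have "(1 + \<bar>real_of_int k\<bar>)\<^sup>2 \<le> 2 * (1 + x)"
      using zero_le_power2[of "1 - \<bar>real_of_int k\<bar>"] by (simp add: x_def power2_eq_square algebra_simps)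
    then have "((1 + \<bar>real_of_int k\<bar>)\<^sup>2)^15 \<le> (2 * (1 + x))^15" by (intro power_mono) auto
    then have "(1 + x) * ((1 + \<bar>real_of_int k\<bar>)^15)\<^sup>2 \<le> (1 + x) * (2 * (1 + x))^15"
      using x by (intro mult_left_mono) (simp_all add: power_mult[symmetric])
    also have "\<dots> = 2^15 * (1 + x)^16"
      unfolding power_mult_distrib using power_Suc[of "1 + x" 15] by simp
    also have "(1 + x)^16 \<le> 2^16 * (1 + x^16)"
    proof (cases "x \<le> 1")
      case True
      have "(1 + x)^16 \<le> 2^16" using True x by (intro power_mono) auto
      also have "\<dots> \<le> 2^16 * (1 + x^16)" using x by simp
      finally show ?thesis .
    next
      case False
      then have "(1 + x)^16 \<le> (2 * x)^16" by (intro power_mono) auto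
      then show ?thesis by (simp add: power_mult_distrib)
    qed
    finally have "(1 + x) * ((1 + \<bar>real_of_int k\<bar>)^15)\<^sup>2 \<le> 2^31 * (1 + x^16)" by simp
    then have "(1 + x) * ((1 + \<bar>real_of_int k\<bar>)^15)\<^sup>2 * (cmod (c t k))\<^sup>2 \<le> 2^31 * (1 + x^16) * (cmod (c t k))\<^sup>2"
      by (rule mult_right_mono) simp
    then show "(1 + (real_of_int k)\<^sup>2) * ((1 + \<bar>real_of_int k\<bar>)^15 * cmod (c t k))\<^sup>2
       \<le> 2^31 * ((real_of_int k^(2 * 0) + real_of_int k^(2 * 16)) * (cmod (c t k))\<^sup>2)"
      unfolding power_mult[of _ 2 16] x_def[symmetric] by (simp add: power_mult_distrib algebra_simps)
  qed simp
  also have "\<dots> = 5 * 2^31 * (energy 0 t + energy 16 t)"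
    unfolding energy_def by (simp add: sum_distrib_left[symmetric] distrib_right sum.distrib)
  also have "\<dots> \<le> 5 * 2^31 * (R + R * exp (loss 16 * gradient_bound R * T))"
    using energy_initial[of 0] mass_conserved[OF t(1)]
      order_trans[OF energy_growth[OF gradient_norm_bounded t, of 16] mult_right_mono[OF energy_initial[of 16]]]
    by (intro mult_left_mono add_mono) auto
  finally show ?thesis unfolding wiener_bound_def by (rule real_le_rsqrt)
qed

end

section \<open>Consistency and stability of the scheme\<close>

text \<open>This and the next two constants bound successive time derivatives at the Wiener levels
  10, 5 and 0, starting from \<open>K\<close> at level 15. By the product rule each
  \<open>quad\<close> contributes a product of two earlier bounds; \<open>disp\<close> contributes
  the factor 2 of \<open>\<bar>k\<bar>^3 + \<bar>k\<bar>^5 \<le> 2 * (1 +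
  \<bar>k\<bar>)^5\<close>.\<close>

definition rate_bound :: "real \<Rightarrow> real" where
  "rate_bound K = K\<^sup>2 + 2 * K"

definition rate2_bound :: "real \<Rightarrow> real" where
  "rate2_bound K = 2 * K * rate_bound K + 2 * rate_bound K"

definition rate3_bound :: "real \<Rightarrow> real" where
  "rate3_bound K = 2 * K * rate2_bound K + 2 * (rate_bound K)\<^sup>2 + 2 * rate2_bound K"

lemma wiener_norm_quad_le':
  assumes "wiener_norm N s' a \<le> A" "wiener_norm N s' b \<le> B" "s < s'"
  shows "wiener_norm N s (quad N a b) \<le> A * B"
proof -
  have "wiener_norm N (Suc s) a \<le> A" "wiener_norm N (Suc s) b \<le> B"
    using assms wiener_norm_mono[of "Suc s" s' N] by (auto intro: order_trans Suc_leI)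
  moreover from this(1) have "0 \<le> A" by (rule order_trans[OF wiener_norm_nonneg])
  ultimately show ?thesis
    by (intro order_trans[OF wiener_norm_quad_le] mult_mono) auto
qed

lemma wiener_norm_disp_le':
  assumes "wiener_norm N s' a \<le> A" "s + 5 \<le> s'"
  shows "wiener_norm N s (disp a) \<le> 2 * A"
  using wiener_norm_disp_le[of N s a] wiener_norm_mono[OF assms(2), of N a] assms(1) by linarith

lemma wiener_norm_add_le':
  assumes "wiener_norm N s a \<le> A" "wiener_norm N s b \<le> B"
  shows "wiener_norm N s (\<lambda>k. a k + b k) \<le> A + B"
  using wiener_norm_add_le[of N s a b] assms by linarith

context galerkin begin

definition rate2 :: "real \<Rightarrow> int \<Rightarrow> complex" where
  "rate2 t k = quad N (rate t) (c t) k + quad N (c t) (rate t) k + disp (rate t) k"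

definition rate3 :: "real \<Rightarrow> int \<Rightarrow> complex" where
  "rate3 t k = (quad N (rate2 t) (c t) k + quad N (rate t) (rate t) k)
    + (quad N (rate t) (rate t) k + quad N (c t) (rate2 t) k) + disp (rate2 t) k"

lemma rate_derivative:
  assumes "0 \<le> t" "k \<in> modes N"
  shows "((\<lambda>s. rate s k) has_vector_derivative rate2 t k) (at t within {0..})"
proof -
  have "((\<lambda>s. quad N (c s) (c s) k + disp (c s) k) has_vector_derivative rate2 t k) (at t within {0..})"
    unfolding rate2_def
    by (intro has_vector_derivative_add quad_has_vector_derivative disp_has_vector_derivative ode' assms)
  then show ?thesis unfolding rate_def .
qed

lemma rate2_derivative:
  assumes "0 \<le> t" "k \<in> modes N"
  shows "((\<lambda>s. rate2 s k) has_vector_derivative rate3 t k) (at t within {0..})"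
proof -
  have "((\<lambda>s. quad N (rate s) (c s) k + quad N (c s) (rate s) k + disp (rate s) k) has_vector_derivative
      rate3 t k) (at t within {0..})"
    unfolding rate3_def
    by (intro has_vector_derivative_add quad_has_vector_derivative disp_has_vector_derivative
        rate_derivative ode' assms)
  then show ?thesis unfolding rate2_def .
qed

lemma rate_bounds:
  assumes K: "wiener_norm N 15 (c t) \<le> K"
  shows "wiener_norm N 10 (rate t) \<le> rate_bound K"
    and "wiener_norm N 0 (rate3 t) \<le> rate3_bound K"
proof -
  have K10: "wiener_norm N 10 (c t) \<le> K"
    using wiener_norm_mono[of 10 15 N "c t"] K by simp
  show 1: "wiener_norm N 10 (rate t) \<le> rate_bound K"
    unfolding rate_def rate_bound_def power2_eq_square
    by (intro wiener_norm_add_le' wiener_norm_quad_le'[OF K K] wiener_norm_disp_le'[OF K]) auto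
  have "wiener_norm N 5 (rate2 t) \<le> rate_bound K * K + K * rate_bound K + 2 * rate_bound K"
    unfolding rate2_def
    by (intro wiener_norm_add_le' wiener_norm_quad_le'[OF 1 K10] wiener_norm_quad_le'[OF K10 1]
        wiener_norm_disp_le'[OF 1]) auto
  then have 2: "wiener_norm N 5 (rate2 t) \<le> rate2_bound K"
    by (simp add: rate2_bound_def algebra_simps)
  have K5: "wiener_norm N 5 (c t) \<le> K"
    using wiener_norm_mono[of 5 15 N "c t"] K by simp
  have "wiener_norm N 0 (rate3 t) \<le> (rate2_bound K * K + rate_bound K * rate_bound K)
      + (rate_bound K * rate_bound K + K * rate2_bound K) + 2 * rate2_bound K"
    unfolding rate3_def
    by (intro wiener_norm_add_le' wiener_norm_quad_le'[OF 2 K5] wiener_norm_quad_le'[OF K5 2]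
        wiener_norm_quad_le'[OF 1 1] wiener_norm_disp_le'[OF 2]) auto
  then show "wiener_norm N 0 (rate3 t) \<le> rate3_bound K"
    by (simp add: rate3_bound_def algebra_simps power2_eq_square)
qed

section \<open>Consistency of the Crank--Nicolson step\<close>

definition average :: "real \<Rightarrow> real \<Rightarrow> int \<Rightarrow> complex" where
  "average t h k = (c t k + c (t + h) k) / 2"

text \<open>The residual of the semidiscrete solution in one step of the scheme. It is not divided
  by \<open>h\<close>, so second-order convergence corresponds to a bound by
  \<open>h^3\<close>.\<close>

definition defect :: "real \<Rightarrow> real \<Rightarrow> int \<Rightarrow> complex" where
  "defect t h k = c (t + h) k - c t k -
     of_real h * (quad N (average t h) (average t h) k + disp (average t h) k)"

lemma wiener_norm_increment_le:
  assumes t: "0 \<le> t" "0 \<le> h" and B: "\<And>x. x \<in> {t..t + h} \<Longrightarrow> wiener_norm N s (rate x) \<le> B"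
  shows "wiener_norm N s (\<lambda>k. c (t + h) k - c t k) \<le> B * h"
proof -
  obtain w where w: "\<And>b. cmod (\<Sum>k\<in>modes N. w k * b k) \<le> wiener_norm N s b"
    "cmod (\<Sum>k\<in>modes N. w k * (c (t + h) k - c t k)) = wiener_norm N s (\<lambda>k. c (t + h) k - c t k)"
    by (rule wiener_norm_dual[of N s "\<lambda>k. c (t + h) k - c t k"]) blast
  define g where "g x = (\<Sum>k\<in>modes N. w k * c x k)" for x
  have "(g has_vector_derivative (\<Sum>k\<in>modes N. w k * rate x k)) (at x within {t..t + h})" if "x \<in> {t..t + h}" for x
  proof -
    have "(g has_vector_derivative (\<Sum>k\<in>modes N. w k * rate x k)) (at x within {0..})"
      unfolding g_def using that t
      by (intro has_vector_derivative_sum bounded_linear.has_vector_derivative[OF bounded_linear_mult_right] ode') auto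
    then show ?thesis by (rule has_vector_derivative_within_subset) (use t in auto)
  qed
  from increment_bound[OF this, where B = B and t = "t + h"] have "norm (g (t + h) - g t) \<le> B * h"
    using order_trans[OF w(1) B] t by auto
  then show ?thesis using w(2) by (simp add: g_def sum_subtractf right_diff_distrib)
qed

lemma wiener_norm_defect_le:
  assumes t: "0 \<le> t" "0 \<le> h" and K: "\<And>x. x \<in> {t..t + h} \<Longrightarrow> wiener_norm N 15 (c x) \<le> K"
  shows "wiener_norm N 0 (defect t h) \<le> (rate3_bound K + (rate_bound K)\<^sup>2) * h^3"
proof -
  \<comment> \<open>\<open>\<tau>\<close> is the error of trapezoidal quadrature for the rate.
    \<open>\<sigma>\<close> replaces the average of the rates by the rate of the average: the linear
    dispersion contributes nothing and the rest is quadratic in an increment of size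
    \<open>h\<close>.\<close>
  define \<tau> where "\<tau> k = c (t + h) k - c t k - (of_real h / 2) * (rate t k + rate (t + h) k)" for k
  define \<sigma> where "\<sigma> k = (of_real h / 4) * quad N (\<lambda>k. c (t + h) k - c t k) (\<lambda>k. c (t + h) k - c t k) k" for k
  have eq: "defect t h = (\<lambda>k. \<tau> k + \<sigma> k)"
  proof
    fix k
    have "disp (average t h) k = (disp (c t) k + disp (c (t + h)) k) / 2"
      by (simp add: disp_def average_def algebra_simps add_divide_distrib)
    then have "(rate t k + rate (t + h) k) / 2 - (quad N (average t h) (average t h) k + disp (average t h) k)
        = quad N (\<lambda>k. c (t + h) k - c t k) (\<lambda>k. c (t + h) k - c t k) k / 4"
      using trapezoid_quad[of N "c t" k "c (t + h)"]
      unfolding average_def[abs_def] rate_def by (simp add: add_divide_distrib algebra_simps)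
    moreover have "y - x - H * G = (y - x - (H / 2) * (p + q)) + (H / 4) * Q"
      if "(p + q) / 2 - G = Q / 4" for x y H G p q Q :: complex
    proof -
      have Q: "Q = 4 * ((p + q) / 2 - G)" unfolding that by simp
      show ?thesis unfolding Q by (simp add: field_simps)
    qed
    ultimately show "defect t h k = \<tau> k + \<sigma> k"
      unfolding defect_def \<tau>_def \<sigma>_def by blast
  qed
  have "wiener_norm N 0 \<tau> \<le> rate3_bound K * h^3"
  proof -
    obtain w where w: "\<And>b. cmod (\<Sum>k\<in>modes N. w k * b k) \<le> wiener_norm N 0 b"
      "cmod (\<Sum>k\<in>modes N. w k * \<tau> k) = wiener_norm N 0 \<tau>"
      by (rule wiener_norm_dual[of N 0 \<tau>]) blast
    have "cmod ((\<Sum>k\<in>modes N. w k * c (t + h) k) - (\<Sum>k\<in>modes N. w k * c t k)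
        - (h / 2) *\<^sub>R ((\<Sum>k\<in>modes N. w k * rate t k) + (\<Sum>k\<in>modes N. w k * rate (t + h) k)))
        \<le> rate3_bound K * h^3"
    proof (rule trapezoid_error[where g = "\<lambda>x. \<Sum>k\<in>modes N. w k * c x k" and ?g1.0 = "\<lambda>x. \<Sum>k\<in>modes N. w k * rate x k"
          and ?g2.0 = "\<lambda>x. \<Sum>k\<in>modes N. w k * rate2 x k" and ?g3.0 = "\<lambda>x. \<Sum>k\<in>modes N. w k * rate3 x k"])
      fix x :: real assume "x \<in> {t..t + h}"
      then show "cmod (\<Sum>k\<in>modes N. w k * rate3 x k) \<le> rate3_bound K"
        by (intro order_trans[OF w(1)] rate_bounds K)
    qed (use t in \<open>auto intro!: has_vector_derivative_sum ode' rate_derivative rate2_derivative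
         bounded_linear.has_vector_derivative[OF bounded_linear_mult_right]\<close>)
    also have "(\<Sum>k\<in>modes N. w k * c (t + h) k) - (\<Sum>k\<in>modes N. w k * c t k)
        - (h / 2) *\<^sub>R ((\<Sum>k\<in>modes N. w k * rate t k) + (\<Sum>k\<in>modes N. w k * rate (t + h) k))
        = (\<Sum>k\<in>modes N. w k * \<tau> k)"
      unfolding \<tau>_def scaleR_conv_of_real sum.distrib[symmetric] sum_distrib_left sum_subtractf[symmetric]
      by (intro sum.cong refl) (simp add: algebra_simps)
    finally show ?thesis using w(2) by simp
  qed
  moreover have "wiener_norm N 0 \<sigma> \<le> (rate_bound K)\<^sup>2 * h^3"
  proof -
    have "wiener_norm N 10 (\<lambda>k. c (t + h) k - c t k) \<le> rate_bound K * h"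
      using t by (intro wiener_norm_increment_le rate_bounds K)
    from wiener_norm_quad_le'[OF this this, of 0]
    have le: "wiener_norm N 0 (quad N (\<lambda>k. c (t + h) k - c t k) (\<lambda>k. c (t + h) k - c t k))
      \<le> (rate_bound K)\<^sup>2 * h\<^sup>2" by (simp add: power2_eq_square ac_simps)
    have "wiener_norm N 0 \<sigma> = (h / 4) * wiener_norm N 0 (quad N (\<lambda>k. c (t + h) k - c t k) (\<lambda>k. c (t + h) k - c t k))"
      unfolding wiener_norm_def \<sigma>_def sum_distrib_left norm_mult using t by (simp add: norm_divide)
    also have "\<dots> \<le> h * ((rate_bound K)\<^sup>2 * h\<^sup>2)"
      using t le by (intro mult_mono) auto
    finally show ?thesis by (simp add: power3_eq_cube power2_eq_square ac_simps)
  qed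
  ultimately show ?thesis unfolding eq
    by (intro order_trans[OF wiener_norm_add_le]) (simp add: distrib_right)
qed

end

section \<open>Stability of the error equation\<close>

text \<open>The nonlinear part of the error equation costs no derivative of the error: the cubic
  self-interaction cancels and the rest moves the derivative onto the exact solution.\<close>

lemma quad_difference_pairing_le:
  assumes real: "\<And>k. k \<in> modes N \<Longrightarrow> e (- k) = cnj (e k)"
  shows "Re (\<Sum>k\<in>modes N. (quad N (\<lambda>k. a k + e k) (\<lambda>k. a k + e k) k - quad N a a k) * cnj (e k))
    \<le> (\<Sum>k\<in>modes N. \<bar>real_of_int k\<bar> * cmod (a k)) * (\<Sum>k\<in>modes N. (cmod (e k))\<^sup>2) / 2"
proof -
  define \<Sigma> where "\<Sigma> = (\<Sum>k\<in>modes N. (quad N (\<lambda>k. a k + e k) (\<lambda>k. a k + e k) k - quad N a a k) * cnj (e k))"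
  define g where "g k = a k + e k" for k
  define A where "A i j l = of_int l * (a i * e j * e l)" for i j l
  define E where "E i j l = of_int l * (e i * e j * e l)" for i j l
  define B where "B = triads N (\<lambda>i j l. of_int i * (a i * e j * e l))"
  have "\<Sigma> = (\<Sum>k\<in>modes N. (quad N g g k - quad N a a k) * e (- k))"
    unfolding \<Sigma>_def g_def using real by (intro sum.cong refl) simp
  also have "\<dots> = (\<Sum>k\<in>modes N. (quad N g g (- k) - quad N a a (- k)) * e k)"
    by (subst sum_modes_uminus[symmetric]) simp
  also have "\<dots> = (\<Sum>k\<in>modes N. (\<i> / 2 * of_int k * e k) * conv N g g (- k)) - (\<Sum>k\<in>modes N. (\<i> / 2 * of_int k * e k) * conv N a a (- k))"
    unfolding sum_subtractf[symmetric] by (intro sum.cong refl) (simp add: quad_def algebra_simps)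
  also have "\<dots> = triads N (\<lambda>i j l. (\<i> / 2) * ((A i j l + A j i l) + E i j l))"
  proof -
    have "triads N (\<lambda>i j l. \<i> / 2 * of_int l * e l * (g i * g j)) =
       triads N (\<lambda>i j l. (\<i> / 2) * ((A i j l + A j i l) + E i j l))
       + triads N (\<lambda>i j l. \<i> / 2 * of_int l * e l * (a i * a j))"
      unfolding triads_add[symmetric] by (rule triads_cong) (simp add: A_def E_def g_def algebra_simps)
    then show ?thesis unfolding sum_conv_eq_triads by simp
  qed
  also have "\<dots> = (\<i> / 2) * (2 * triads N A + triads N E)"
    unfolding triads_mult_left triads_add triads_swap12[of N A] by simp
  \<comment> \<open>Symmetrising the two slots of \<open>e\<close> replaces the multiplier
    \<open>l\<close> by \<open>(j + l) / 2\<close>, which is \<open>- i / 2\<close> on a resonant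
    triad.\<close>
  also have "2 * triads N A = - B"
  proof -
    have "2 * triads N A = triads N (\<lambda>i j l. A i j l + A i l j)"
      unfolding triads_add triads_swap23[of N A] by simp
    also have "\<dots> = triads N (\<lambda>i j l. (- 1) * (of_int i * (a i * e j * e l)))"
    proof (rule triads_cong)
      fix i j l :: int assume "i + j + l = 0"
      then have i: "i = - (j + l)" by simp
      show "A i j l + A i l j = (- 1) * (of_int i * (a i * e j * e l))"
        unfolding A_def i by (simp add: algebra_simps)
    qed
    finally show ?thesis unfolding triads_mult_left B_def by simp
  qed
  \<comment> \<open>The same cancellation as for the mass: symmetrised over all three slots, the
    multiplier is \<open>i + j + l\<close>.\<close>
  also have "triads N E = 0"
  proof -
    have "3 * triads N E = triads N (\<lambda>i j l. (E i j l + E i l j) + E l j i)"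
      unfolding triads_add triads_swap23[of N E] triads_swap13[of N E] by simp
    also have "\<dots> = triads N (\<lambda>i j l. 0 * e 0)"
    proof (rule triads_cong)
      fix i j l :: int assume "i + j + l = 0"
      then have i: "i = - (j + l)" by simp
      show "(E i j l + E i l j) + E l j i = 0 * e 0"
        unfolding E_def i by (simp add: algebra_simps)
    qed
    finally show ?thesis unfolding triads_mult_left by simp
  qed
  finally have "\<Sigma> = - (\<i> / 2) * B" by simp
  then have "Re \<Sigma> \<le> norm B / 2"
    using complex_Re_le_cmod[of \<Sigma>] by (simp add: norm_mult norm_divide)
  also have "norm B \<le> triads N (\<lambda>i j l. (\<bar>real_of_int i\<bar> * cmod (a i)) * (cmod (e j) * cmod (e l)))"
    unfolding B_def by (rule norm_triads_le) (simp add: norm_mult ac_simps)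
  also have "\<dots> \<le> (\<Sum>k\<in>modes N. \<bar>real_of_int k\<bar> * cmod (a k)) * (\<Sum>k\<in>modes N. (cmod (e k))\<^sup>2)"
    by (rule triads_le_l1_l2) simp
  finally show ?thesis unfolding \<Sigma>_def by simp
qed

definition l2 :: "nat \<Rightarrow> (int \<Rightarrow> complex) \<Rightarrow> real" where
  "l2 N e = sqrt (\<Sum>k\<in>modes N. (cmod (e k))\<^sup>2)"

lemma l2_nonneg [simp]: "0 \<le> l2 N e"
  by (simp add: l2_def sum_nonneg)

lemma l2_square: "(l2 N e)\<^sup>2 = (\<Sum>k\<in>modes N. (cmod (e k))\<^sup>2)"
  by (simp add: l2_def sum_nonneg)

lemma l2_average_le: "l2 N (\<lambda>k. (a k + b k) / 2) \<le> (l2 N a + l2 N b) / 2"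
proof -
  have "l2 N (\<lambda>k. (a k + b k) / 2) = L2_set (\<lambda>k. cmod ((a k + b k) / 2)) (modes N)"
    by (simp add: l2_def L2_set_def)
  also have "\<dots> \<le> L2_set (\<lambda>k. (1/2) * cmod (a k) + (1/2) * cmod (b k)) (modes N)"
  proof (rule L2_set_mono)
    show "cmod ((a k + b k) / 2) \<le> (1/2) * cmod (a k) + (1/2) * cmod (b k)" for k
      using norm_triangle_ineq[of "a k" "b k"] by (simp add: norm_divide)
  qed simp
  also have "\<dots> \<le> L2_set (\<lambda>k. (1/2) * cmod (a k)) (modes N) + L2_set (\<lambda>k. (1/2) * cmod (b k)) (modes N)"
    by (rule L2_set_triangle_ineq)
  also have "\<dots> = (l2 N a + l2 N b) / 2"
    by (simp add: L2_set_right_distrib[symmetric] l2_def L2_set_def[symmetric] del: times_divide_eq_left)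
  finally show ?thesis .
qed

lemma cmod_le_l2: "k \<in> modes N \<Longrightarrow> cmod (e k) \<le> l2 N e"
  unfolding l2_def by (rule real_le_rsqrt) (rule member_le_sum, auto)

text \<open>Testing with the midpoint error and dividing by \<open>l2 N e + l2 N e'\<close> gives an estimate that is
  linear in the norms.\<close>

lemma crank_nicolson_step_stability:
  assumes real: "\<And>k. k \<in> modes N \<Longrightarrow> e (- k) = cnj (e k)" "\<And>k. k \<in> modes N \<Longrightarrow> e' (- k) = cnj (e' k)"
    and step: "\<And>k. k \<in> modes N \<Longrightarrow> e' k - e k = of_real h *
       (quad N (\<lambda>k. a k + (e k + e' k) / 2) (\<lambda>k. a k + (e k + e' k) / 2) k - quad N a a k
        + disp (\<lambda>k. (e k + e' k) / 2) k) - \<rho> k"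
    and h: "0 \<le> h" and D: "(\<Sum>k\<in>modes N. \<bar>real_of_int k\<bar> * cmod (a k)) \<le> D"
  shows "l2 N e' - l2 N e \<le> h * D / 4 * (l2 N e + l2 N e') + wiener_norm N 0 \<rho>"
proof -
  define m where "m k = (e k + e' k) / 2" for k
  define \<sigma> where "\<sigma> = l2 N e + l2 N e'"
  have \<sigma>: "\<sigma> \<ge> 0" by (simp add: \<sigma>_def)
  have D0: "D \<ge> 0" using order_trans[OF sum_nonneg D] by simp
  have rm: "m (- k) = cnj (m k)" if "k \<in> modes N" for k using real that by (simp add: m_def)
  have lm: "l2 N m \<le> \<sigma> / 2" unfolding m_def \<sigma>_def by (rule l2_average_le)
  have "((l2 N e')\<^sup>2 - (l2 N e)\<^sup>2) / 2 = Re (\<Sum>k\<in>modes N. (e' k - e k) * cnj (m k))"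
    unfolding l2_square sum_subtractf[symmetric] sum_divide_distrib Re_sum
  proof (intro sum.cong refl)
    show "((cmod (e' k))\<^sup>2 - (cmod (e k))\<^sup>2) / 2 = Re ((e' k - e k) * cnj (m k))" for k
      unfolding cmod_power2 m_def by (simp add: power2_eq_square field_simps)
  qed
  also have "(\<Sum>k\<in>modes N. (e' k - e k) * cnj (m k)) =
      of_real h * (\<Sum>k\<in>modes N. (quad N (\<lambda>k. a k + m k) (\<lambda>k. a k + m k) k - quad N a a k) * cnj (m k))
      + of_real h * (\<Sum>k\<in>modes N. disp m k * cnj (m k)) - (\<Sum>k\<in>modes N. \<rho> k * cnj (m k))"
    unfolding sum_distrib_left sum.distrib[symmetric] sum_subtractf[symmetric]
    by (intro sum.cong refl) (simp add: step m_def[symmetric, abs_def] algebra_simps)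
  also have "Re \<dots> = h * Re (\<Sum>k\<in>modes N. (quad N (\<lambda>k. a k + m k) (\<lambda>k. a k + m k) k - quad N a a k) * cnj (m k))
      - Re (\<Sum>k\<in>modes N. \<rho> k * cnj (m k))"
  proof -
    have "Re (disp m k * cnj (m k)) = 0" for k
      unfolding disp_def mult.assoc complex_norm_square[symmetric] by (simp del: of_real_power)
    then have "Re (\<Sum>k\<in>modes N. disp m k * cnj (m k)) = 0" unfolding Re_sum by (simp only: sum.neutral_const)
    then show ?thesis
      unfolding minus_complex.sel plus_complex.sel times_complex.sel Re_complex_of_real Im_complex_of_real by simp
  qed
  also have "\<dots> \<le> h * (D * (\<sigma> / 2)\<^sup>2 / 2) + wiener_norm N 0 \<rho> * (\<sigma> / 2)"
  proof -
    have "Re (\<Sum>k\<in>modes N. (quad N (\<lambda>k. a k + m k) (\<lambda>k. a k + m k) k - quad N a a k) * cnj (m k))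
        \<le> (\<Sum>k\<in>modes N. \<bar>real_of_int k\<bar> * cmod (a k)) * (l2 N m)\<^sup>2 / 2"
      unfolding l2_square by (rule quad_difference_pairing_le[where e = m, OF rm])
    also have "\<dots> \<le> D * (\<sigma> / 2)\<^sup>2 / 2"
      using D D0 lm by (intro divide_right_mono mult_mono power_mono) auto
    finally have "h * Re (\<Sum>k\<in>modes N. (quad N (\<lambda>k. a k + m k) (\<lambda>k. a k + m k) k - quad N a a k) * cnj (m k))
        \<le> h * (D * (\<sigma> / 2)\<^sup>2 / 2)" using h by (intro mult_left_mono)
    \<comment> \<open>An \<open>l^1\<close>-\<open>l^\<infinity>\<close> pairing: every coefficient
      of \<open>m\<close> is at most \<open>l2 N m\<close>, so the Wiener norm of the residual can
      be used directly.\<close>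
    moreover have "- Re (\<Sum>k\<in>modes N. \<rho> k * cnj (m k)) \<le> wiener_norm N 0 \<rho> * (\<sigma> / 2)"
    proof -
      have "- Re (\<Sum>k\<in>modes N. \<rho> k * cnj (m k)) \<le> (\<Sum>k\<in>modes N. cmod (\<rho> k) * cmod (m k))"
        using abs_Re_le_cmod[of "\<Sum>k\<in>modes N. \<rho> k * cnj (m k)"]
          norm_sum[of "\<lambda>k. \<rho> k * cnj (m k)" "modes N"] by (simp add: norm_mult)
      also have "\<dots> \<le> (\<Sum>k\<in>modes N. cmod (\<rho> k) * (\<sigma> / 2))"
        by (intro sum_mono mult_left_mono order_trans[OF cmod_le_l2 lm]) auto
      finally show ?thesis
        unfolding sum_distrib_right[symmetric] by (simp only: wiener_norm_def power_0 mult_1)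
    qed
    ultimately show ?thesis by linarith
  qed
  finally have "(l2 N e' - l2 N e) * \<sigma> \<le> (h * D / 4 * \<sigma> + wiener_norm N 0 \<rho>) * \<sigma>"
    by (simp add: \<sigma>_def power2_eq_square field_simps)
  then show ?thesis
  proof (cases "\<sigma> = 0")
    case True
    then have "l2 N e' = 0" "l2 N e = 0" using l2_nonneg[of N e] l2_nonneg[of N e'] unfolding \<sigma>_def by linarith+
    then show ?thesis by simp
  qed (use \<sigma> in \<open>simp add: \<sigma>_def[symmetric]\<close>)
qed

section \<open>Discrete Gronwall inequality and the global error\<close>

text \<open>The recursion is implicit in \<open>x (Suc m)\<close>. For \<open>q \<le> 1/2\<close>
  solving for it costs little: \<open>(1 + q) / (1 - q) \<le> 1 + 4 * q\<close> and
  \<open>1 / (1 - q) \<le> 2\<close>; then \<open>1 + 4 * q \<le> exp (4 * q)\<close>.\<close>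

lemma discrete_gronwall:
  fixes x :: "nat \<Rightarrow> real"
  assumes step: "\<And>m. m < M \<Longrightarrow> x (Suc m) - x m \<le> q * (x m + x (Suc m)) + p"
    and x0: "x 0 = 0" and xn: "\<And>m. 0 \<le> x m" and q: "0 \<le> q" "q \<le> 1/2" and p: "0 \<le> p" and m: "m \<le> M"
  shows "x m \<le> 2 * p * real m * exp (4 * q * real m)"
  using m
proof (induction m)
  case (Suc m)
  have "(1 - q) * x (Suc m) \<le> (1 + q) * x m + p"
    using step[of m] Suc.prems by (simp add: algebra_simps)
  also have "\<dots> \<le> (1 - q) * ((1 + 4 * q) * x m + 2 * p)"
  proof -
    have "1 + q \<le> (1 - q) * (1 + 4 * q)"
      using mult_nonneg_nonneg[of q "1 - 2 * q"] q by (simp add: algebra_simps)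
    moreover have "p \<le> (1 - q) * (2 * p)"
      using mult_right_mono[of "1/2" "1 - q" "2 * p"] q p by simp
    moreover have "(1 + q) * x m \<le> (1 - q) * ((1 + 4 * q) * x m)"
      using mult_right_mono[OF calculation(1) xn[of m]] by (simp only: mult.assoc)
    ultimately show ?thesis
      unfolding distrib_left[of "1 - q" "(1 + 4 * q) * x m"] by (intro add_mono)
  qed
  finally have "x (Suc m) \<le> (1 + 4 * q) * x m + 2 * p" using q by simp
  also have "\<dots> \<le> exp (4 * q) * (2 * p * real m * exp (4 * q * real m)) + exp (4 * q * real (Suc m)) * (2 * p)"
  proof (rule add_mono)
    show "(1 + 4 * q) * x m \<le> exp (4 * q) * (2 * p * real m * exp (4 * q * real m))"
      using Suc xn[of m] exp_ge_add_one_self[of "4 * q"] by (intro mult_mono) auto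
    show "2 * p \<le> exp (4 * q * real (Suc m)) * (2 * p)"
      using mult_right_mono[of 1 "exp (4 * q * real (Suc m))" "2 * p"] q p by simp
  qed
  also have "\<dots> = 2 * p * real (Suc m) * exp (4 * q * real (Suc m))"
    by (simp add: algebra_simps exp_add)
  finally show ?case .
qed (simp add: x0)

definition defect_const :: "real \<Rightarrow> real \<Rightarrow> real" where
  "defect_const R T = rate3_bound (wiener_bound R T) + (rate_bound (wiener_bound R T))\<^sup>2"

text \<open>The discrete Gronwall bound for \<open>q = h * gradient_bound R / 4\<close> and
  \<open>p = defect_const R T * h^3\<close>, with \<open>real m * h \<le> T\<close> used in the
  exponent and once more to trade one power of \<open>h\<close>.\<close>

definition error_const :: "real \<Rightarrow> real \<Rightarrow> real" where
  "error_const R T = 2 * defect_const R T * T * exp (gradient_bound R * T)"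

lemma (in galerkin_sobolev) crank_nicolson_error:
  fixes v :: "nat \<Rightarrow> int \<Rightarrow> complex"
  assumes h: "0 \<le> h" "real M * h \<le> T" "h * gradient_bound R \<le> 2"
    and real: "\<And>m k. m \<le> M \<Longrightarrow> k \<in> modes N \<Longrightarrow> v m (- k) = cnj (v m k)"
    and init: "\<And>k. k \<in> modes N \<Longrightarrow> v 0 k = c 0 k"
    and step: "\<And>m k. m < M \<Longrightarrow> k \<in> modes N \<Longrightarrow> v (Suc m) k - v m k = of_real h *
        (quad N (\<lambda>k. (v m k + v (Suc m) k) / 2) (\<lambda>k. (v m k + v (Suc m) k) / 2) k
          + disp (\<lambda>k. (v m k + v (Suc m) k) / 2) k)"
    and m: "m \<le> M"
  shows "l2 N (\<lambda>k. v m k - c (real m * h) k) \<le> error_const R T * h\<^sup>2"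
proof -
  define D where "D = gradient_bound R"
  define K where "K = wiener_bound R T"
  define p where "p = defect_const R T * h^3"
  define x where "x m = l2 N (\<lambda>k. v m k - c (real m * h) k)" for m
  have D0: "0 \<le> D"
    using gradient_norm_bounded[of 0] gradient_norm_nonneg[of 0] by (simp add: D_def)
  have mh: "real m * h \<le> T" if "m \<le> M" for m
    using that h mult_right_mono[of "real m" "real M" h] by simp
  have T: "0 \<le> T" using mh[of 0] by simp
  have K0: "0 \<le> K"
    using order_trans[OF wiener_norm_nonneg wiener_norm_bounded[of 0]] T by (simp add: K_def)
  then have dc: "0 \<le> defect_const R T"
    by (simp add: defect_const_def K_def[symmetric] rate_bound_def rate2_bound_def rate3_bound_def)
  have "x m \<le> 2 * p * real m * exp (4 * (h * D / 4) * real m)"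
  proof (rule discrete_gronwall[where M = M])
    fix m assume "m < M"
    define t where "t = real m * h"
    have t: "0 \<le> t" "t + h \<le> T" "real (Suc m) * h = t + h"
      using h(1) mh[of "Suc m"] \<open>m < M\<close> by (simp_all add: t_def algebra_simps)
    define e where "e k = v m k - c t k" for k
    define e' where "e' k = v (Suc m) k - c (t + h) k" for k
    have "l2 N e' - l2 N e \<le> h * D / 4 * (l2 N e + l2 N e') + wiener_norm N 0 (defect t h)"
    \<comment> \<open>The reference state is the average of the two semidiscrete values: adding the
      averaged error to it gives precisely the midpoint of the scheme.\<close>
    proof (rule crank_nicolson_step_stability[where a = "average t h"])
      fix k assume k: "k \<in> modes N"
      show "e (- k) = cnj (e k)" "e' (- k) = cnj (e' k)"
        using k \<open>m < M\<close> t h by (simp_all add: e_def e'_def real reality)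
      have mid: "average t h k + (e k + e' k) / 2 = (v m k + v (Suc m) k) / 2" for k
        by (simp add: average_def e_def e'_def field_simps)
      have "disp (\<lambda>k. (v m k + v (Suc m) k) / 2) k = disp (average t h) k + disp (\<lambda>k. (e k + e' k) / 2) k"
        unfolding mid[symmetric] by (simp add: disp_def algebra_simps)
      then show "e' k - e k = of_real h *
         (quad N (\<lambda>k. average t h k + (e k + e' k) / 2) (\<lambda>k. average t h k + (e k + e' k) / 2) k
           - quad N (average t h) (average t h) k + disp (\<lambda>k. (e k + e' k) / 2) k) - defect t h k"
        unfolding mid using step[OF \<open>m < M\<close> k]
        by (simp add: e_def e'_def defect_def algebra_simps)
    next
      have "(\<Sum>k\<in>modes N. \<bar>real_of_int k\<bar> * cmod (average t h k))
          \<le> (\<Sum>k\<in>modes N. (\<bar>real_of_int k\<bar> * cmod (c t k) + \<bar>real_of_int k\<bar> * cmod (c (t + h) k)) / 2)"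
      proof (rule sum_mono)
        fix k :: int
        have "cmod (average t h k) \<le> (cmod (c t k) + cmod (c (t + h) k)) / 2"
          using norm_triangle_ineq[of "c t k" "c (t + h) k"] by (simp add: average_def norm_divide)
        then show "\<bar>real_of_int k\<bar> * cmod (average t h k) \<le>
            (\<bar>real_of_int k\<bar> * cmod (c t k) + \<bar>real_of_int k\<bar> * cmod (c (t + h) k)) / 2"
          using mult_left_mono[of "cmod (average t h k)" _ "\<bar>real_of_int k\<bar>"]
          by (fastforce simp: distrib_left)
      qed
      also have "\<dots> = (gradient_norm t + gradient_norm (t + h)) / 2"
        unfolding gradient_norm_def sum_divide_distrib[symmetric] sum.distrib ..
      also have "\<dots> \<le> D"
        using gradient_norm_bounded[of t] gradient_norm_bounded[of "t + h"] t h(1) by (simp add: D_def)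
      finally show "(\<Sum>k\<in>modes N. \<bar>real_of_int k\<bar> * cmod (average t h k)) \<le> D" .
    qed (use h in auto)
    moreover have "wiener_norm N 0 (defect t h) \<le> p"
      unfolding p_def defect_const_def
      by (rule wiener_norm_defect_le) (use t h in \<open>auto intro!: wiener_norm_bounded\<close>)
    ultimately show "x (Suc m) - x m \<le> h * D / 4 * (x m + x (Suc m)) + p"
      unfolding x_def t(3) t_def[symmetric] e_def e'_def by linarith
  next
    have "x 0 = l2 N (\<lambda>k. 0)"
      unfolding x_def l2_def using init by (intro arg_cong[of _ _ sqrt] sum.cong refl) simp
    then show "x 0 = 0" by (simp add: l2_def)
  qed (use m h D0 dc in \<open>auto simp: x_def p_def D_def\<close>)
  also have "\<dots> = 2 * p * real m * exp (D * (real m * h))" by (simp add: ac_simps)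
  also have "\<dots> \<le> 2 * p * real m * exp (D * T)"
    using mh[OF m] D0 dc h by (intro mult_left_mono) (auto simp: p_def intro!: mult_left_mono)
  also have "\<dots> = (2 * defect_const R T * exp (D * T) * h\<^sup>2) * (real m * h)"
    by (simp add: p_def power3_eq_cube power2_eq_square ac_simps)
  also have "\<dots> \<le> (2 * defect_const R T * exp (D * T) * h\<^sup>2) * T"
    using mh[OF m] dc by (intro mult_left_mono) auto
  finally show ?thesis by (simp add: x_def error_const_def D_def ac_simps)
qed

section \<open>Trigonometric polynomials\<close>

definition expo :: "int \<Rightarrow> real \<Rightarrow> complex" where
  "expo k x = exp (\<i> * of_int k * of_real x)"

definition trig :: "nat \<Rightarrow> (int \<Rightarrow> complex) \<Rightarrow> real \<Rightarrow> complex" where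
  "trig N c x = (\<Sum>k\<in>modes N. c k * expo k x)"

lemma expo_0 [simp]: "expo 0 x = 1"
  by (simp add: expo_def)

lemma expo_mult: "expo k x * expo l x = expo (k + l) x"
  by (simp add: expo_def exp_add[symmetric] algebra_simps)

lemma cnj_expo: "cnj (expo k x) = expo (- k) x"
  by (simp add: expo_def exp_cnj)

lemma norm_expo [simp]: "cmod (expo k x) = 1"
  by (simp add: expo_def norm_exp_eq_Re)

lemma continuous_on_expo [continuous_intros]: "continuous_on S (expo k)"
  unfolding expo_def by (intro continuous_intros)

lemma continuous_on_trig [continuous_intros]: "continuous_on S (trig N c)"
  unfolding trig_def by (intro continuous_intros)

lemma expo_has_vector_derivative: "(expo k has_vector_derivative \<i> * of_int k * expo k x) (at x within S)"
  unfolding expo_def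
  by (rule has_vector_derivative_real_field[THEN has_vector_derivative_at_within] derivative_eq_intros refl | simp)+

lemma trig_polys_eq: "trig_polys N = range (trig N)"
  unfolding trig_polys_def trig_def expo_def modes_def by (auto simp: fun_eq_iff image_def)

lemma trig_cong: "(\<And>k. k \<in> modes N \<Longrightarrow> a k = b k) \<Longrightarrow> trig N a = trig N b"
  unfolding trig_def by (simp cong: sum.cong)

lemma trig_add: "trig N a x + trig N b x = trig N (\<lambda>k. a k + b k) x"
  by (simp add: trig_def sum.distrib distrib_right)

lemma trig_diff: "trig N a x - trig N b x = trig N (\<lambda>k. a k - b k) x"
  by (simp add: trig_def sum_subtractf left_diff_distrib)

lemma expo_in_trig_polys:
  assumes "k \<in> modes N"
  shows "expo k \<in> trig_polys N"
proof -
  have "expo k = trig N (\<lambda>l. if k = l then 1 else 0)"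
    unfolding trig_def fun_eq_iff using assms by (simp add: if_distrib[of "\<lambda>z. z * _"] cong: if_cong)
  then show ?thesis by (simp add: trig_polys_eq)
qed

lemma trig_extend:
  assumes "N \<le> M"
  shows "trig N a = trig M (\<lambda>k. if k \<in> modes N then a k else 0)"
proof
  fix x
  have "modes N \<subseteq> modes M" using assms by (auto simp: modes_def)
  then show "trig N a x = trig M (\<lambda>k. if k \<in> modes N then a k else 0) x"
    unfolding trig_def by (intro sum.mono_neutral_cong_left) auto
qed

lemma trig_mult: "trig N a x * trig N b x = trig (2 * N) (conv N a b) x"
proof -
  have "trig (2 * N) (conv N a b) x =
      (\<Sum>k\<in>modes (2 * N). \<Sum>i\<in>modes N. \<Sum>j\<in>modes N. if i + j = k then a i * b j * expo k x else 0)"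
    unfolding trig_def conv_def sum_distrib_right by (intro sum.cong refl) auto
  also have "\<dots> = (\<Sum>i\<in>modes N. \<Sum>j\<in>modes N. \<Sum>k\<in>modes (2 * N). if i + j = k then a i * b j * expo k x else 0)"
    by (subst sum.swap, rule sum.cong[OF refl], subst sum.swap, rule refl)
  also have "\<dots> = (\<Sum>i\<in>modes N. \<Sum>j\<in>modes N. a i * b j * expo (i + j) x)"
    by (intro sum.cong refl) (auto simp: modes_def)
  also have "\<dots> = trig N a x * trig N b x"
    unfolding trig_def sum_product by (intro sum.cong refl) (simp add: expo_mult[symmetric] ac_simps)
  finally show ?thesis ..
qed

lemma trig_has_vector_derivative:
  "(trig N c has_vector_derivative trig N (\<lambda>k. \<i> * of_int k * c k) x) (at x within S)"
proof -
  have "((\<lambda>x. \<Sum>k\<in>modes N. c k * expo k x) has_vector_derivative (\<Sum>k\<in>modes N. c k * (\<i> * of_int k * expo k x))) (at x within S)"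
    by (intro has_vector_derivative_sum bounded_linear.has_vector_derivative[OF bounded_linear_mult_right] expo_has_vector_derivative)
  then show ?thesis by (simp add: trig_def[abs_def] ac_simps)
qed

lemma dx_trig: "dx (trig N c) = trig N (\<lambda>k. \<i> * of_int k * c k)"
  unfolding dx_def by (intro ext vector_derivative_at trig_has_vector_derivative)

text \<open>The product \<open>U U_x\<close> has degree \<open>2 * N\<close>, but test functions see
  only the modes up to \<open>N\<close>. The sign reflects that \<open>quad\<close> and
  \<open>disp\<close> stand on the right-hand side of the evolution equation.\<close>

lemma spatial_op_trig:
  obtains s where "spatial_op (trig N a) = trig (2 * N) s"
    "\<And>k. k \<in> modes N \<Longrightarrow> s k = - (quad N a a k + disp a k)"
proof
  define d where "d k = (\<i> * of_int k)^3 * a k - (\<i> * of_int k)^5 * a k" for k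
  define s where "s k = conv N a (\<lambda>j. \<i> * of_int j * a j) k + (if k \<in> modes N then d k else 0)" for k
  have 3: "(dx ^^ 3) (trig N a) = trig N (\<lambda>k. (\<i> * of_int k)^3 * a k)"
    by (simp add: eval_nat_numeral dx_trig mult.assoc)
  have 5: "(dx ^^ 5) (trig N a) = trig N (\<lambda>k. (\<i> * of_int k)^5 * a k)"
    by (simp add: eval_nat_numeral dx_trig mult.assoc)
  show "spatial_op (trig N a) = trig (2 * N) s"
  proof
    fix x
    have "spatial_op (trig N a) x = trig (2 * N) (conv N a (\<lambda>j. \<i> * of_int j * a j)) x + trig N d x"
      unfolding spatial_op_def 3 5 dx_trig trig_mult add_diff_eq[symmetric] trig_diff d_def ..
    also have "trig N d x = trig (2 * N) (\<lambda>k. if k \<in> modes N then d k else 0) x"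
      by (subst trig_extend[of N "2 * N"]) auto
    finally show "spatial_op (trig N a) x = trig (2 * N) s x" by (simp add: trig_add s_def[abs_def])
  qed
  show "s k = - (quad N a a k + disp a k)" if "k \<in> modes N" for k
  proof -
    \<comment> \<open>Product rule for the square; by commutativity each of the two convolutions is
      half of the right-hand side.\<close>
    have "conv N a (\<lambda>j. \<i> * of_int j * a j) k + conv N (\<lambda>j. \<i> * of_int j * a j) a k = \<i> * of_int k * conv N a a k"
      unfolding conv_def sum.distrib[symmetric] sum_distrib_left
      by (intro sum.cong refl) (auto simp: algebra_simps)
    then have "conv N a (\<lambda>j. \<i> * of_int j * a j) k = - quad N a a k"
      unfolding conv_commute[of N "\<lambda>j. \<i> * of_int j * a j"] quad_def by (simp add: mult.commute[of _ 2])
    moreover have "d k = - disp a k"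
      unfolding d_def disp_def by (simp add: eval_nat_numeral algebra_simps)
    ultimately show ?thesis using that by (simp add: s_def)
  qed
qed

section \<open>Orthogonality, Fourier coefficients and the projection\<close>

lemma set_integrable_continuous:
  fixes f :: "real \<Rightarrow> complex"
  assumes "continuous_on UNIV f"
  shows "set_integrable lebesgue {a..b} f"
  by (rule absolutely_integrable_continuous_real) (rule continuous_on_subset[OF assms], simp)

lemma set_integrable_mult_expo:
  assumes "set_integrable lebesgue A f"
  shows "set_integrable lebesgue A (\<lambda>x. expo k x * f x)"
proof (rule set_integrable_bound[OF assms])
  have "expo k \<in> borel_measurable lebesgue"
    using borel_measurable_continuous_onI[OF continuous_on_expo] measurable_completion by (simp add: measurable_completion)
  moreover have "(\<lambda>x. indicator A x *\<^sub>R f x) \<in> borel_measurable lebesgue"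
    using assms unfolding set_integrable_def by (rule borel_measurable_integrable)
  ultimately have "(\<lambda>x. expo k x * (indicator A x *\<^sub>R f x)) \<in> borel_measurable lebesgue"
    by (rule borel_measurable_times)
  then show "set_borel_measurable lebesgue A (\<lambda>x. expo k x * f x)"
    unfolding set_borel_measurable_def by (simp add: mult.left_commute scaleR_conv_of_real)
qed (simp add: norm_mult)

lemma set_integral_sum_complex:
  fixes f :: "'i \<Rightarrow> 'a \<Rightarrow> complex"
  assumes "\<And>i. i \<in> I \<Longrightarrow> set_integrable M A (f i)"
  shows "(LINT x:A|M. \<Sum>i\<in>I. f i x) = (\<Sum>i\<in>I. LINT x:A|M. f i x)"
  using assms unfolding set_lebesgue_integral_def set_integrable_def scaleR_sum_right
  by (rule Bochner_Integration.integral_sum)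

lemma set_integral_expo: "(LINT x:{-pi..pi}|lebesgue. expo m x) = (if m = 0 then of_real (2 * pi) else 0)"
proof (cases "m = 0")
  case False
  have "(expo m has_integral (expo m pi / (\<i> * of_int m) - expo m (- pi) / (\<i> * of_int m))) {-pi..pi}"
  proof (rule fundamental_theorem_of_calculus)
    fix x
    have "((\<lambda>x. expo m x / (\<i> * of_int m)) has_vector_derivative (\<i> * of_int m * expo m x) / (\<i> * of_int m)) (at x within {-pi..pi})"
      by (intro has_vector_derivative_divide expo_has_vector_derivative)
    then show "((\<lambda>x. expo m x / (\<i> * of_int m)) has_vector_derivative expo m x) (at x within {-pi..pi})"
      using False by simp
  qed simp
  moreover have "expo m pi = expo m (- pi)"
  proof -
    have "\<i> * of_int m * of_real pi = \<i> * of_int m * of_real (- pi) + \<i> * (of_int m * (of_real pi * 2))"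
      by (simp add: algebra_simps)
    then show ?thesis unfolding expo_def by (simp only: exp_plus_2pin)
  qed
  ultimately have "(expo m has_integral 0) {-pi..pi}" by simp
  then show ?thesis
    using False by (simp add: set_lebesgue_integral_eq_integral set_integrable_continuous continuous_on_expo integral_unique)
next
  case True
  have "(LINT x:{-pi..pi}|lebesgue. (1::complex)) = integral {-pi..pi} (\<lambda>x. 1)"
    by (rule set_lebesgue_integral_eq_integral(2)) (rule set_integrable_continuous, simp)
  with True show ?thesis by (simp add: scaleR_conv_of_real)
qed

lemma fourier_coeff_eq: "fourier_coeff f k = (LINT x:{-pi..pi}|lebesgue. expo (- k) x * f x) / of_real (2 * pi)"
  by (simp add: fourier_coeff_def expo_def)

lemma fourier_coeff_trig: "fourier_coeff (trig N a) k = (if k \<in> modes N then a k else 0)"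
proof -
  have "(LINT x:{-pi..pi}|lebesgue. expo (- k) x * trig N a x)
     = (LINT x:{-pi..pi}|lebesgue. \<Sum>j\<in>modes N. a j * expo (j - k) x)"
    unfolding trig_def sum_distrib_left
    by (intro arg_cong[of _ _ "\<lambda>f. set_lebesgue_integral lebesgue {-pi..pi} f"] ext sum.cong refl)
      (simp add: mult.left_commute[of "expo (- k) _"] expo_mult)
  also have "\<dots> = (\<Sum>j\<in>modes N. LINT x:{-pi..pi}|lebesgue. a j * expo (j - k) x)"
    by (intro set_integral_sum_complex set_integrable_continuous continuous_intros)
  also have "\<dots> = (\<Sum>j\<in>modes N. if k = j then a j * of_real (2 * pi) else 0)"
    by (intro sum.cong refl) (simp add: set_integral_expo)
  also have "\<dots> = (if k \<in> modes N then a k * of_real (2 * pi) else 0)"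
    by (simp add: sum.delta)
  finally show ?thesis unfolding fourier_coeff_eq by simp
qed

lemma L2_inner_expo: "L2_inner f (expo k) = of_real (2 * pi) * fourier_coeff f k"
  unfolding L2_inner_def fourier_coeff_eq by (simp add: cnj_expo mult.commute)

lemma L2_inner_trig:
  assumes "set_integrable lebesgue {-pi..pi} f"
  shows "L2_inner f (trig N b) = (\<Sum>k\<in>modes N. of_real (2 * pi) * (fourier_coeff f k * cnj (b k)))"
proof -
  have "L2_inner f (trig N b) = (LINT x:{-pi..pi}|lebesgue. \<Sum>k\<in>modes N. cnj (b k) * (expo (- k) x * f x))"
    unfolding L2_inner_def trig_def cnj_sum sum_distrib_left
    by (simp add: cnj_expo ac_simps)
  also have "\<dots> = (\<Sum>k\<in>modes N. LINT x:{-pi..pi}|lebesgue. cnj (b k) * (expo (- k) x * f x))"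
    by (intro set_integral_sum_complex set_integrable_mult_right set_integrable_mult_expo assms)
  also have "\<dots> = (\<Sum>k\<in>modes N. of_real (2 * pi) * (fourier_coeff f k * cnj (b k)))"
    by (intro sum.cong refl) (simp add: fourier_coeff_eq)
  finally show ?thesis .
qed

lemma L2_norm_trig: "L2_norm (trig N a) = sqrt (2 * pi) * l2 N a"
proof -
  have "z * cnj z = (of_real (cmod z))\<^sup>2" for z using complex_norm_square[of z] by simp
  then have "L2_inner (trig N a) (trig N a) = of_real (2 * pi * (\<Sum>k\<in>modes N. (cmod (a k))\<^sup>2))"
    unfolding sum_distrib_left of_real_sum
    by (subst L2_inner_trig) (auto intro!: set_integrable_continuous continuous_intros sum.cong
      simp: fourier_coeff_trig)
  then show ?thesis by (simp add: L2_norm_def l2_def real_sqrt_mult)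
qed

lemma L2_per_integrable:
  assumes "f \<in> L2_per"
  shows "set_integrable lebesgue {-pi..pi} f"
proof (rule set_integrable_bound)
  show "set_integrable lebesgue {-pi..pi} (\<lambda>x. 1 + (cmod (f x))\<^sup>2)"
    using assms by (intro set_integral_add(1) absolutely_integrable_continuous_real[OF continuous_on_const])
      (simp add: L2_per_def)
  have "a \<le> 1 + a\<^sup>2" for a :: real
    using zero_le_power2[of "a - 1/2"] by (simp add: power2_eq_square algebra_simps)
  then show "AE x in lebesgue. x \<in> {-pi..pi} \<longrightarrow> cmod (f x) \<le> norm (1 + (cmod (f x))\<^sup>2)"
    by (simp add: abs_of_nonneg)
qed (use assms in \<open>simp add: L2_per_def\<close>)

lemma fourier_coeff_diff_trig:
  assumes "set_integrable lebesgue {-pi..pi} f" "k \<in> modes N"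
  shows "fourier_coeff (\<lambda>x. f x - trig N a x) k = fourier_coeff f k - a k"
proof -
  have "set_integrable lebesgue {-pi..pi} (trig N a)"
    by (intro set_integrable_continuous continuous_intros)
  then have "fourier_coeff (\<lambda>x. f x - trig N a x) k = fourier_coeff f k - fourier_coeff (trig N a) k"
    unfolding fourier_coeff_eq right_diff_distrib
    by (subst set_integral_diff(2)) (auto intro!: set_integrable_mult_expo assms simp: diff_divide_distrib)
  with assms(2) show ?thesis by (simp add: fourier_coeff_trig)
qed

text \<open>Testing with single exponentials fixes each coefficient in \<open>modes N\<close>, which
  gives the uniqueness demanded by \<open>THE\<close> as an equality of functions.\<close>

lemma L2_proj_eq:
  assumes "f \<in> L2_per"
  shows "L2_proj N f = trig N (fourier_coeff f)"
  unfolding L2_proj_def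
proof (rule the_equality)
  note int = L2_per_integrable[OF assms]
  have "L2_inner (\<lambda>x. f x - trig N (fourier_coeff f) x) \<phi> = 0" if "\<phi> \<in> trig_polys N" for \<phi>
  proof -
    from that obtain b where \<phi>: "\<phi> = trig N b" by (auto simp: trig_polys_eq)
    have "set_integrable lebesgue {-pi..pi} (\<lambda>x. f x - trig N (fourier_coeff f) x)"
      by (intro set_integral_diff int set_integrable_continuous continuous_intros)
    then show ?thesis unfolding \<phi> by (simp add: L2_inner_trig fourier_coeff_diff_trig int)
  qed
  then show "trig N (fourier_coeff f) \<in> trig_polys N \<and>
      (\<forall>\<phi>\<in>trig_polys N. L2_inner (\<lambda>x. f x - trig N (fourier_coeff f) x) \<phi> = 0)"
    by (auto simp: trig_polys_eq)
  fix p assume p: "p \<in> trig_polys N \<and> (\<forall>\<phi>\<in>trig_polys N. L2_inner (\<lambda>x. f x - p x) \<phi> = 0)"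
  then obtain b where b: "p = trig N b" by (auto simp: trig_polys_eq)
  have "b k = fourier_coeff f k" if "k \<in> modes N" for k
    using p expo_in_trig_polys[OF that] that int
    by (auto simp: b L2_inner_expo fourier_coeff_diff_trig)
  then show "p = trig N (fourier_coeff f)" unfolding b by (rule trig_cong)
qed

section \<open>Coefficients from point values\<close>

text \<open>The coefficients of an element of \<open>trig_polys N\<close> are recovered from finitely many point values,
  so pointwise differentiability in time passes to them.\<close>

definition dft :: "nat \<Rightarrow> (real \<Rightarrow> complex) \<Rightarrow> int \<Rightarrow> complex" where
  "dft N f k = (\<Sum>j<2 * N + 1. expo (- k) (2 * pi * real j / real (2 * N + 1)) * f (2 * pi * real j / real (2 * N + 1)))
     / of_nat (2 * N + 1)"

text \<open>A geometric sum over powers of an \<open>n\<close>-th root of unity;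
  \<open>\<bar>m\<bar> < int n\<close> prevents a nonzero \<open>m\<close> from being a multiple of
  \<open>n\<close>, which would give the root 1.\<close>

lemma sum_expo_roots:
  assumes "\<bar>m\<bar> < int n"
  shows "(\<Sum>j<n. expo m (2 * pi * real j / real n)) = (if m = 0 then of_nat n else 0)"
proof (cases "m = 0")
  case False
  have n: "n > 0" using assms by simp
  define z where "z = expo m (2 * pi / real n)"
  have pow: "expo m (2 * pi * real j / real n) = z ^ j" for j
    unfolding z_def expo_def exp_of_nat_mult[symmetric] by (simp add: ac_simps)
  have "z \<noteq> 1"
  proof
    assume "z = 1"
    then obtain l :: int where "real_of_int m * (2 * pi / real n) = of_int (2 * l) * pi"
      unfolding z_def expo_def exp_eq_1 by auto
    then have "real_of_int m = real_of_int l * real n" using n by (simp add: field_simps)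
    then have "real_of_int m = real_of_int (l * int n)" by simp
    then have m: "m = l * int n" by (simp only: of_int_eq_iff)
    with False have "1 \<le> \<bar>l\<bar>" by auto
    then have "int n \<le> \<bar>m\<bar>" unfolding m abs_mult using mult_right_mono[of 1 "\<bar>l\<bar>" "int n"] by simp
    with assms show False by simp
  qed
  moreover have "z ^ n = 1"
  proof -
    have "z ^ n = exp (0 + \<i> * (of_int m * (of_real pi * 2)))"
      unfolding pow[symmetric] expo_def using n by (simp add: ac_simps)
    then show ?thesis by (simp only: exp_plus_2pin exp_zero)
  qed
  ultimately show ?thesis unfolding pow using False by (simp add: sum_gp_strict)
qed simp

lemma dft_trig:
  assumes "k \<in> modes N"
  shows "dft N (trig N c) k = c k"
proof -
  define n where "n = 2 * N + 1"
  define x where "x j = 2 * pi * real j / real n" for j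
  have "(\<Sum>j<n. expo (- k) (x j) * trig N c (x j)) = (\<Sum>j<n. \<Sum>l\<in>modes N. c l * expo (l - k) (x j))"
    unfolding trig_def sum_distrib_left
    by (intro sum.cong refl) (simp add: mult.left_commute[of "expo (- k) _"] expo_mult)
  also have "\<dots> = (\<Sum>l\<in>modes N. c l * (\<Sum>j<n. expo (l - k) (x j)))"
    by (subst sum.swap) (simp add: sum_distrib_left)
  also have "\<dots> = (\<Sum>l\<in>modes N. if k = l then c l * of_nat n else 0)"
  proof (intro sum.cong refl)
    fix l assume "l \<in> modes N"
    \<comment> \<open>Two modes differ by at most \<open>2 * N\<close>, so \<open>2 * N + 1\<close>
      nodes just avoid aliasing.\<close>
    then have "\<bar>l - k\<bar> < int n" using assms by (auto simp: modes_def n_def)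
    then show "c l * (\<Sum>j<n. expo (l - k) (x j)) = (if k = l then c l * of_nat n else 0)"
      unfolding x_def by (subst sum_expo_roots) auto
  qed
  also have "\<dots> = c k * of_nat n" using assms by (simp add: sum.delta)
  finally have "(\<Sum>j<n. expo (- k) (x j) * trig N c (x j)) = c k * of_nat n" .
  moreover have "of_nat n \<noteq> (0::complex)" unfolding of_nat_eq_0_iff by (simp add: n_def)
  ultimately show ?thesis
    unfolding dft_def n_def[symmetric] x_def[symmetric] by simp
qed

lemma trig_dft: "f \<in> trig_polys N \<Longrightarrow> trig N (dft N f) = f"
  by (auto simp: trig_polys_eq dft_trig intro!: trig_cong)

lemma dft_uminus:
  assumes "real_valued f"
  shows "dft N f (- k) = cnj (dft N f k)"
proof -
  have "cnj (f x) = f x" for x using assms by (simp add: real_valued_def Reals_cnj_iff)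
  then show ?thesis unfolding dft_def by (simp add: cnj_expo)
qed

text \<open>Makes the derivative within \<open>{0..}\<close> unique, also at
  \<open>t = 0\<close>.\<close>

lemma at_within_atLeast_ne_bot:
  assumes "0 \<le> (t::real)"
  shows "at t within {0..} \<noteq> bot"
proof -
  have "at_right t \<le> at t within {0..}" using assms by (intro at_le) auto
  then show ?thesis using trivial_limit_at_right_real[of t] by (metis bot.extremum_uniqueI)
qed

lemma dft_has_vector_derivative:
  assumes "\<And>x. (\<lambda>s. U s x) differentiable (at t within S)"
  shows "((\<lambda>s. dft N (U s) k) has_vector_derivative dft N (\<lambda>x. vector_derivative (\<lambda>s. U s x) (at t within S)) k) (at t within S)"
  unfolding dft_def
  by (intro has_vector_derivative_divide has_vector_derivative_sum
      bounded_linear.has_vector_derivative[OF bounded_linear_mult_right] vector_derivative_works[THEN iffD1] assms)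

section \<open>Convergence\<close>

lemma semidiscrete_solution_galerkin:
  assumes "semidiscrete_solution N u0 U"
  shows "galerkin N (\<lambda>t. dft N (U t))"
proof
  note sol = assms[unfolded semidiscrete_solution_def]
  fix t :: real and k assume t: "0 \<le> t" and k: "k \<in> modes N"
  show "dft N (U t) (- k) = cnj (dft N (U t) k)" using sol t by (intro dft_uminus) auto
  define c' where "c' k = dft N (dt_U U t) k" for k
  have der: "((\<lambda>s. dft N (U s) k) has_vector_derivative c' k) (at t within {0..})" for k
    unfolding c'_def dt_U_def using sol t by (intro dft_has_vector_derivative) auto
  \<comment> \<open>That the pointwise time derivative stays in \<open>trig_polys N\<close> is not
    part of its definition; it follows by differentiating the expansion of \<open>U s x\<close> in
    the sampled coefficients.\<close>
  have dt: "dt_U U t = trig N c'"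
  proof
    fix x
    have "((\<lambda>s. trig N (dft N (U s)) x) has_vector_derivative trig N c' x) (at t within {0..})"
      unfolding trig_def
      by (intro has_vector_derivative_sum bounded_linear.has_vector_derivative[OF bounded_linear_mult_left] der)
    then have "((\<lambda>s. U s x) has_vector_derivative trig N c' x) (at t within {0..})"
      by (rule has_vector_derivative_transform[rotated 2]) (use sol t in \<open>auto simp: trig_dft\<close>)
    then show "dt_U U t x = trig N c' x"
      unfolding dt_U_def by (intro vector_derivative_within at_within_atLeast_ne_bot t)
  qed
  define a where "a = dft N (U t)"
  have U: "U t = trig N a" unfolding a_def using sol t by (simp add: trig_dft)
  obtain s where s: "spatial_op (trig N a) = trig (2 * N) s" "\<And>k. k \<in> modes N \<Longrightarrow> s k = - (quad N a a k + disp a k)"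
    using spatial_op_trig[of N a] by metis
  have k2: "k \<in> modes (2 * N)" using k by (auto simp: modes_def)
  have "(\<lambda>x. dt_U U t x + spatial_op (U t) x) = trig (2 * N) (\<lambda>k. (if k \<in> modes N then c' k else 0) + s k)"
    unfolding dt U s(1) by (subst trig_extend[of N "2 * N"]) (auto simp: trig_add)
  then have "fourier_coeff (\<lambda>x. dt_U U t x + spatial_op (U t) x) k = c' k + s k"
    using k k2 by (simp add: fourier_coeff_trig)
  moreover have "L2_inner (\<lambda>x. dt_U U t x + spatial_op (U t) x) (expo k) = 0"
    using sol t expo_in_trig_polys[OF k] by blast
  ultimately have "c' k + s k = 0" unfolding L2_inner_expo by simp
  then have "c' k = quad N a a k + disp a k" using s(2)[OF k] by algebra
  with der[of k] show "((\<lambda>s. dft N (U s) k) has_vector_derivative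
      quad N (dft N (U t)) (dft N (U t)) k + disp (dft N (U t)) k) (at t within {0..})"
    by (simp add: a_def)
qed

lemma crank_nicolson_coefficients:
  assumes "crank_nicolson N M h v0 V" "m < M" and k: "k \<in> modes N"
  defines "a \<equiv> (\<lambda>k. (dft N (V m) k + dft N (V (Suc m)) k) / 2)"
  shows "dft N (V (Suc m)) k - dft N (V m) k = of_real h * (quad N a a k + disp a k)"
proof -
  have V: "V m = trig N (dft N (V m))" "V (Suc m) = trig N (dft N (V (Suc m)))"
    using assms(1,2) by (auto simp: crank_nicolson_def trig_dft)
  have mid: "midpoint_step V m = trig N a"
  proof
    fix x
    have "midpoint_step V m x = (trig N (dft N (V m)) x + trig N (dft N (V (Suc m))) x) / 2"
      unfolding midpoint_step_def V[symmetric] ..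
    then show "midpoint_step V m x = trig N a x"
      unfolding trig_add by (simp add: trig_def a_def sum_divide_distrib)
  qed
  obtain s where s: "spatial_op (trig N a) = trig (2 * N) s" "\<And>k. k \<in> modes N \<Longrightarrow> s k = - (quad N a a k + disp a k)"
    using spatial_op_trig[of N a] by metis
  have k2: "k \<in> modes (2 * N)" using k by (auto simp: modes_def)
  have diff: "(\<lambda>x. V (Suc m) x - V m x) = trig N (\<lambda>k. dft N (V (Suc m)) k - dft N (V m) k)"
    by (subst V(1), subst V(2)) (simp add: trig_diff)
  have "L2_inner (\<lambda>x. V (Suc m) x - V m x) (expo k)
      + of_real h * L2_inner (spatial_op (midpoint_step V m)) (expo k) = 0"
    using assms(1,2) expo_in_trig_polys[OF k] by (auto simp: crank_nicolson_def)
  then have "of_real (2 * pi) * ((dft N (V (Suc m)) k - dft N (V m) k) + of_real h * s k) = 0"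
    unfolding diff mid s(1) L2_inner_expo fourier_coeff_trig using k k2 by (simp add: algebra_simps)
  then have "(dft N (V (Suc m)) k - dft N (V m) k) + of_real h * s k = 0" by simp
  then show ?thesis using s(2)[OF k] by algebra
qed

theorem theorem5p1:
  fixes T :: real and r :: nat and u0 :: "real \<Rightarrow> complex"
  assumes "0 < T" and "16 \<le> r"
    and "u0 \<in> H_per r" and "real_valued u0"
  shows "\<exists>C1>0. \<exists>C>0. \<forall>(N::nat) (M::nat) (\<Delta>t::real) (U :: real \<Rightarrow> real \<Rightarrow> complex)
            (V :: nat \<Rightarrow> real \<Rightarrow> complex).
      0 < N \<longrightarrow> 0 < M \<longrightarrow> \<Delta>t = T / real M \<longrightarrow> real N * \<Delta>t \<le> C1 \<longrightarrow>
      semidiscrete_solution N u0 U \<longrightarrow> crank_nicolson N M \<Delta>t (U 0) V \<longrightarrow>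
      (MAX m\<in>{0..M}. L2_norm (\<lambda>x. V m x - U (real m * \<Delta>t) x)) \<le> C * \<Delta>t\<^sup>2"
proof -
  \<comment> \<open>The full sum over all modes dominates every truncated initial sum, which makes
    it independent of \<open>N\<close>.\<close>
  define R where "R = (\<Sum>\<^sub>\<infinity>k. (1 + (real_of_int k)\<^sup>2) ^ r * (cmod (fourier_coeff u0 k))\<^sup>2)"
  define D where "D = gradient_bound R"
  \<comment> \<open>The absolute value and the added 1 guarantee positivity.\<close>
  define C where "C = sqrt (2 * pi) * \<bar>error_const R T\<bar> + 1"
  have L2: "u0 \<in> L2_per" and
    summable: "(\<lambda>k. (1 + (real_of_int k)\<^sup>2) ^ r * (cmod (fourier_coeff u0 k))\<^sup>2) summable_on UNIV"
    using assms(3) by (auto simp: H_per_def)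
  have R0: "0 \<le> R" unfolding R_def by (rule infsum_nonneg) simp
  then have D0: "0 \<le> D" by (simp add: D_def gradient_bound_def)
  have C0: "0 < C" by (simp add: C_def add_nonneg_pos)
  have "(MAX m\<in>{0..M}. L2_norm (\<lambda>x. V m x - U (real m * h) x)) \<le> C * h\<^sup>2"
    if "0 < N" "0 < M" "h = T / real M" "real N * h \<le> 2 / (D + 1)"
      and sol: "semidiscrete_solution N u0 U" and cn: "crank_nicolson N M h (U 0) V"
    for N M :: nat and h U V
  proof -
    interpret galerkin N "\<lambda>t. dft N (U t)" using sol by (rule semidiscrete_solution_galerkin)
    have "dft N (U 0) k = fourier_coeff u0 k" if "k \<in> modes N" for k
      using sol that by (simp add: semidiscrete_solution_def L2_proj_eq[OF L2] dft_trig)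
    then have "(\<Sum>k\<in>modes N. (1 + (real_of_int k)\<^sup>2)^16 * (cmod (dft N (U 0) k))\<^sup>2)
        \<le> (\<Sum>k\<in>modes N. (1 + (real_of_int k)\<^sup>2)^r * (cmod (fourier_coeff u0 k))\<^sup>2)"
      using assms(2) by (intro sum_mono) (auto intro!: mult_right_mono power_increasing)
    also have "\<dots> \<le> R" unfolding R_def by (rule finite_sum_le_infsum[OF summable]) auto
    finally interpret galerkin_sobolev N "\<lambda>t. dft N (U t)" R T by unfold_locales
    have h: "0 \<le> h" "real M * h \<le> T" using that assms(1) by simp_all
    \<comment> \<open>Since \<open>N\<close> is at least 1, the mesh condition bounds
      \<open>h\<close> itself. The goal \<open>h * D \<le> 2\<close> is the condition
      \<open>q \<le> 1/2\<close> of the discrete Gronwall inequality with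
      \<open>q = h * D / 4\<close>; the 1 in \<open>D + 1\<close> keeps the quotient meaningful for
      \<open>D = 0\<close>.\<close>
    have "h \<le> real N * h" using that(1) h(1) mult_right_mono[of 1 "real N" h] by simp
    then have "h \<le> 2 / (D + 1)" using that(4) by linarith
    then have "h * (D + 1) \<le> 2" using D0 by (simp add: field_simps)
    then have hD: "h * D \<le> 2" using h(1) by (simp add: algebra_simps)
    have "L2_norm (\<lambda>x. V m x - U (real m * h) x) \<le> C * h\<^sup>2" if m: "m \<le> M" for m
    proof -
      have V: "V m = trig N (dft N (V m))" if "m \<le> M" for m
        using cn that by (auto simp: crank_nicolson_def trig_dft)
      have U: "U (real m * h) = trig N (dft N (U (real m * h)))"
        using sol h(1) by (simp add: semidiscrete_solution_def trig_dft)
      have "l2 N (\<lambda>k. dft N (V m) k - dft N (U (real m * h)) k) \<le> error_const R T * h\<^sup>2"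
      proof (rule crank_nicolson_error[OF h hD[unfolded D_def] _ _ _ m])
        show "dft N (V m) (- k) = cnj (dft N (V m) k)" if "m \<le> M" for m k
          using cn that by (intro dft_uminus) (auto simp: crank_nicolson_def)
        show "dft N (V 0) k = dft N (U 0) k" for k using cn by (simp add: crank_nicolson_def)
      qed (rule crank_nicolson_coefficients[OF cn])
      moreover have "(\<lambda>x. V m x - U (real m * h) x) = trig N (\<lambda>k. dft N (V m) k - dft N (U (real m * h)) k)"
        by (subst V[OF m], subst U) (simp add: trig_diff)
      ultimately have "L2_norm (\<lambda>x. V m x - U (real m * h) x) \<le> sqrt (2 * pi) * (error_const R T * h\<^sup>2)"
        by (simp add: L2_norm_trig mult_left_mono)
      also have "\<dots> = (sqrt (2 * pi) * error_const R T) * h\<^sup>2" by simp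
      also have "\<dots> \<le> C * h\<^sup>2"
        unfolding C_def by (intro mult_right_mono add_increasing2 mult_left_mono) auto
      finally show ?thesis .
    qed
    then show ?thesis by (intro Max.boundedI) auto
  qed
  then show ?thesis
    using C0 D0 by (intro exI[of _ "2 / (D + 1)"] conjI exI[of _ C]) (auto simp: add_nonneg_pos)
qed

end
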